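(* Let $\mathbf{M}\in\mathbb{R}^{N\times N}$ be symmetric with eigenvalues $\lambda_1>\lambda_2>\cdots>\lambda_r>\lambda_{r+1}\ge\cdots\ge\lambda_N$, and let $d_{\min}=\min_{1\le s<j\le r+1}(\lambda_s-\lambda_j)$. Set $\epsilon=\frac{1}{72}r^{-1}d_{\min}$ and $\eta=0.11\,d_{\min}$. Then for every $\mathbf{X}\in\mathrm{St}(N,r)$ with $\|\mathrm{grad}\,g(\mathbf{X})\|_F\le\epsilon$ we have $|\lambda_{\min}(\mathrm{hess}\,g(\mathbf{X}))|\ge\eta$.
   Context: $\mathrm{St}(N,r)=\{\mathbf{X}\in\mathbb{R}^{N\times r}:\mathbf{X}^\top\mathbf{X}=\mathbf{I}_r\}$, $\mathbf{N}=\mathrm{diag}(r,r-1,\dots,1)\in\mathbb{R}^{r\times r}$, $g(\mathbf{X})=-\tfrac12\mathrm{tr}(\mathbf{X}^\top\mathbf{M}\mathbf{X}\mathbf{N})$ on $\mathrm{St}(N,r)$. $\mathcal{T}_{\mathbf{X}}\mathrm{St}(N,r)=\{\mathbf{U}:\mathbf{X}^\top\mathbf{U}+\mathbf{U}^\top\mathbf{X}=\mathbf{0}\}$. $\mathrm{grad}\,g(\mathbf{X})=(\mathbf{X}\mathbf{X}^\top-\mathbf{I}_N)\mathbf{M}\mathbf{X}\mathbf{N}-\tfrac12\mathbf{X}[\mathbf{X}^\top\mathbf{M}\mathbf{X},\mathbf{N}]$ with $[\mathbf{A},\mathbf{B}]=\mathbf{A}\mathbf{B}-\mathbf{B}\mathbf{A}$;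 $\mathrm{hess}\,g(\mathbf{X})[\mathbf{U},\mathbf{U}]=\langle\mathbf{X}^\top\mathbf{M}\mathbf{X},\mathbf{U}^\top\mathbf{U}\mathbf{N}\rangle-\langle\mathbf{M},\mathbf{U}\mathbf{N}\mathbf{U}^\top\rangle$ for $\mathbf{U}\in\mathcal{T}_{\mathbf{X}}\mathrm{St}(N,r)$; $\lambda_{\min}(\mathrm{hess}\,g(\mathbf{X}))$ is the minimum of this form over $\mathbf{U}\in\mathcal{T}_{\mathbf{X}}\mathrm{St}(N,r)$ with $\|\mathbf{U}\|_F=1$. *)

theory Defs
  imports Jordan_Normal_Form.Char_Poly
begin

definition frob_inner :: "real mat \<Rightarrow> real mat \<Rightarrow> real" where
  "frob_inner A B = (\<Sum>i<dim_row A. \<Sum>j<dim_col A. A $$ (i,j) * B $$ (i,j))"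

definition frob_norm :: "real mat \<Rightarrow> real" where
  "frob_norm A = sqrt (frob_inner A A)"

definition stiefel :: "nat \<Rightarrow> nat \<Rightarrow> real mat set" where
  "stiefel N r = {X. X \<in> carrier_mat N r \<and> X\<^sup>T * X = 1\<^sub>m r}"

definition Nmat :: "nat \<Rightarrow> real mat" where
  "Nmat r = mat r r (\<lambda>(i,j). if i = j then real (r - i) else 0)"

definition commutator :: "real mat \<Rightarrow> real mat \<Rightarrow> real mat" where
  "commutator A B = A * B - B * A"

definition tangent_stiefel :: "nat \<Rightarrow> nat \<Rightarrow> real mat \<Rightarrow> real mat set" where
  "tangent_stiefel N r X = {U. U \<in> carrier_mat N r \<and> X\<^sup>T * U + U\<^sup>T * X = 0\<^sub>m r r}"

(* Riemannian gradient of g(X) = -1/2 tr(X^T M X N) *)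
definition grad_g :: "real mat \<Rightarrow> nat \<Rightarrow> real mat \<Rightarrow> real mat" where
  "grad_g M r X = (X * X\<^sup>T - 1\<^sub>m (dim_row X)) * M * X * Nmat r
                  - (1/2) \<cdot>\<^sub>m (X * commutator (X\<^sup>T * M * X) (Nmat r))"

definition hess_g :: "real mat \<Rightarrow> nat \<Rightarrow> real mat \<Rightarrow> real mat \<Rightarrow> real" where
  "hess_g M r X U = frob_inner (X\<^sup>T * M * X) (U\<^sup>T * U * Nmat r) - frob_inner M (U * Nmat r * U\<^sup>T)"

definition lambda_min_hess :: "real mat \<Rightarrow> nat \<Rightarrow> nat \<Rightarrow> real mat \<Rightarrow> real" where
  "lambda_min_hess M N r X =
     Inf {hess_g M r X U | U. U \<in> tangent_stiefel N r X \<and> frob_norm U = 1}"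

end

theory Submission
  imports Defs
begin

text \<open>
  In an orthonormal eigenbasis of \<open>M\<close> the problem becomes one about \<open>r\<close> orthonormal vectors
  \<open>x\<^sub>j\<close> and a diagonal form \<open>q\<close> with entries \<open>l\<close>. Pythagoras splits the gradient into the parts along
  and orthogonal to the frame, so a gradient of norm at most \<open>\<epsilon>\<close> forces the residuals
  \<open>M x\<^sub>j - q(x\<^sub>j, x\<^sub>j) x\<^sub>j\<close> to have total norm at most \<open>\<delta> = 2 \<epsilon>\<close>. Hence each Rayleigh quotient
  \<open>q(x\<^sub>j, x\<^sub>j)\<close> is within \<open>\<delta>\<close> of an eigenvalue, and up to an error \<open>3 r \<delta> = d/12\<close> the Hessian is the
  one of an exact critical point:
  \<open>\<Sum>j i. (r - j) (q(x\<^sub>j, x\<^sub>j) - q(x\<^sub>i, x\<^sub>i)) s\<^sub>i\<^sub>j\<^sup>2 + \<Sum>j. (r - j) (q(x\<^sub>j, x\<^sub>j) |k\<^sub>j|\<^sup>2 - q(k\<^sub>j, k\<^sub>j))\<close>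
  for \<open>U = X S + K\<close> with \<open>S\<close> skew and \<open>K\<close> orthogonal to \<open>X\<close>.

  If some Rayleigh quotient is near one of the eigenvalues \<open>l r, l (r + 1), ...\<close>, then one of
  the top \<open>r\<close> eigenvectors is missed by the frame, and moving a column towards it is a direction of
  negative curvature. If the quotients are near the top \<open>r\<close> eigenvalues but in the wrong order,
  rotating two columns into each other is such a direction. Otherwise the Hessian is positive
  definite; here a dimension count bounds \<open>q\<close> on the orthogonal complement of the frame.
\<close>

section \<open>Orthogonal diagonalization and homogeneous systems\<close>

lemma exists_orthogonal_mat_with_first_col:
  fixes v :: "real vec"
  assumes v: "v \<in> carrier_vec n" and unit: "v \<bullet> v = 1" and n: "0 < n"
  shows "\<exists>W. W \<in> carrier_mat n n \<and> W\<^sup>T * W = 1\<^sub>m n \<and> col W 0 = v"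
proof -
  define u where "u i = v $ i - (if i = 0 then 1 else 0)" for i
  define t where "t = (\<Sum>i<n. (u i)\<^sup>2)"
  define c where "c = 2 / t"
  \<comment> \<open>The Householder reflection exchanging the first unit vector and \<open>v\<close>; if they coincide,
    then \<open>t = 0\<close>, hence \<open>c = 2 / 0 = 0\<close> and \<open>W\<close> is the identity.\<close>
  define W where "W = mat n n (\<lambda>(i,j). (if i = j then 1 else 0) - c * u i * u j)"
  have W: "W \<in> carrier_mat n n" by (simp add: W_def)
  have vv: "(\<Sum>i<n. (v $ i)\<^sup>2) = 1"
    using unit v by (simp add: scalar_prod_def power2_eq_square lessThan_atLeast0)
  have t_eq: "t = - 2 * u 0"
  proof -
    have "(u i)\<^sup>2 = (v $ i)\<^sup>2 + (if i = 0 then 1 - 2 * v $ 0 else 0)" for i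
      by (simp add: u_def power2_eq_square algebra_simps)
    then have "t = 1 + (\<Sum>i<n. if i = 0 then 1 - 2 * v $ 0 else 0)"
      by (simp add: t_def sum.distrib vv)
    also have "\<dots> = - 2 * u 0"
      using n by (subst sum.delta) (auto simp: u_def)
    finally show ?thesis .
  qed
  have cct: "c * c * t = 2 * c"
    by (cases "t = 0") (simp_all add: c_def field_simps)
  have col: "col W 0 = v"
  proof (rule eq_vecI)
    fix i assume "i < dim_vec v"
    then have i: "i < n" using v by simp
    have "u i = 0" if "t = 0"
    proof -
      have "(u i)\<^sup>2 = 0"
        using that i sum_nonneg_eq_0_iff[of "{..<n}" "\<lambda>i. (u i)\<^sup>2"] unfolding t_def by auto
      then show ?thesis by simp
    qed
    moreover have "c * u 0 = -1" if "t \<noteq> 0"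
      using that t_eq by (simp add: c_def field_simps)
    ultimately have "u i * (c * u 0) = - u i"
      by (cases "t = 0") auto
    then have "c * u i * u 0 = - u i" by (simp only: mult_ac)
    then show "col W 0 $ i = v $ i"
      using i n by (simp add: W_def u_def)
  qed (use v in \<open>simp add: W_def\<close>)
  have "W\<^sup>T * W = 1\<^sub>m n"
  proof (rule eq_matI)
    fix i j assume "i < dim_row (1\<^sub>m n :: real mat)" "j < dim_col (1\<^sub>m n :: real mat)"
    then have ij: "i < n" "j < n" by auto
    have "(W\<^sup>T * W) $$ (i,j) = (\<Sum>k<n. ((if k = i then 1 else 0) - c * u k * u i) * ((if k = j then 1 else 0) - c * u k * u j))"
      using ij by (simp add: W_def scalar_prod_def lessThan_atLeast0)
    also have "\<dots> = (\<Sum>k<n. (if k = i then (if i = j then 1 else 0) - c * u i * u j else 0)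
        + (if k = j then - c * u i * u j else 0) + (c * c * u i * u j) * (u k)\<^sup>2)"
      by (rule sum.cong) (auto simp: algebra_simps power2_eq_square)
    also have "\<dots> = (if i = j then 1 else 0) - 2 * c * u i * u j + (c * c * t) * (u i * u j)"
      using ij by (simp add: sum.distrib sum.delta t_def sum_distrib_left algebra_simps)
    also have "\<dots> = (if i = j then 1 else 0)" unfolding cct by simp
    finally show "(W\<^sup>T * W) $$ (i,j) = 1\<^sub>m n $$ (i,j)" using ij by simp
  qed (auto simp: W_def)
  with W col show ?thesis by blast
qed

lemma symmetric_mat_orthogonally_diagonalizable:
  fixes A :: "real mat"
  assumes "A \<in> carrier_mat n n" and "A\<^sup>T = A"
    and "char_poly A = (\<Prod>e\<leftarrow>es. [:- e, 1:])"
  shows "\<exists>V. similar_mat_wit A (mat_diag n ((!) es)) V (V\<^sup>T)"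
  using assms
proof (induct es arbitrary: n A)
  case Nil
  with degree_monic_char_poly[of A n] have n0: "n = 0" by auto
  have "A = mat_diag n ((!) [])" using Nil(1) n0 by (intro eq_matI) (auto simp: mat_diag_def)
  with similar_mat_wit_refl[OF Nil(1)] show ?case
    by (intro exI[of _ "1\<^sub>m n"]) simp
next
  case (Cons e es)
  note A = Cons(2)
  have cp: "char_poly A = [:- e, 1:] * (\<Prod>e\<leftarrow>es. [:- e, 1:])" using Cons(4) by simp
  have mon: "monic (\<Prod>e\<leftarrow>es. [:- e, 1:])" by (rule monic_prod_list) auto
  have "degree (char_poly A) = Suc (degree (\<Prod>e\<leftarrow>es. [:- e, 1:]))"
    unfolding cp by (subst degree_mult_eq) (use mon in auto)
  with degree_monic_char_poly[OF A] obtain m where n: "n = Suc m"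
    by (cases n) auto
  have "eigenvalue A e" unfolding eigenvalue_root_char_poly[OF A] cp by simp
  then obtain v0 where v0: "v0 \<in> carrier_vec n" "v0 \<noteq> 0\<^sub>v n" "A *\<^sub>v v0 = e \<cdot>\<^sub>v v0"
    using A unfolding eigenvalue_def eigenvector_def by auto
  have pos: "v0 \<bullet> v0 > 0"
  proof -
    obtain i where i: "i < n" "v0 $ i \<noteq> 0" using v0 by (metis eq_vecI carrier_vecD index_zero_vec)
    have "0 < v0 $ i * v0 $ i" using i by (auto simp: zero_less_mult_iff)
    also have "\<dots> \<le> (\<Sum>i = 0..<n. v0 $ i * v0 $ i)"
      by (rule member_le_sum) (use i in auto)
    finally show ?thesis using v0 by (simp add: scalar_prod_def)
  qed
  define v where "v = (1 / sqrt (v0 \<bullet> v0)) \<cdot>\<^sub>v v0"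
  have v: "v \<in> carrier_vec n" using v0 by (simp add: v_def)
  have Av: "A *\<^sub>v v = e \<cdot>\<^sub>v v"
    unfolding v_def using v0 A
    by (simp add: mult_mat_vec[OF A] smult_smult_assoc mult.commute)
  have "v \<bullet> v = 1" unfolding v_def using v0 pos by (simp add: field_simps)
  from exists_orthogonal_mat_with_first_col[OF v this] n obtain W where
    W: "W \<in> carrier_mat n n" "W\<^sup>T * W = 1\<^sub>m n" "col W 0 = v" by auto
  have WT: "W\<^sup>T \<in> carrier_mat n n" using W by simp
  have WWT: "W * W\<^sup>T = 1\<^sub>m n" using mat_mult_left_right_inverse[OF WT W(1) W(2)] .
  define A' where "A' = W\<^sup>T * A * W"
  have A': "A' \<in> carrier_mat n n" using A W by (simp add: A'_def)
  have "A'\<^sup>T = W\<^sup>T * (A\<^sup>T * W)" unfolding A'_def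
    using A W WT by (simp add: transpose_mult[of _ n n _ n])
  then have A'T: "A'\<^sup>T = A'"
    unfolding A'_def Cons(3) using assoc_mult_mat[OF WT A W(1)] by simp
  have sim: "similar_mat_wit A A' W (W\<^sup>T)"
  proof (rule similar_mat_witI[OF WWT W(2) _ A A' W(1) WT])
    have "W * (W\<^sup>T * A * W) * W\<^sup>T = (W * W\<^sup>T) * A * (W * W\<^sup>T)"
      using A W WT by (simp add: assoc_mult_mat[of _ n n _ n _ n])
    then show "A = W * A' * W\<^sup>T" using A by (simp add: WWT A'_def)
  qed
  have col0: "A' $$ (i, 0) = (if i = 0 then e else 0)" if i: "i < n" for i
  proof -
    have "col A' 0 = W\<^sup>T *\<^sub>v (A *\<^sub>v v)"
      unfolding A'_def assoc_mult_mat[OF WT A W(1)] W(3)[symmetric]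
      using col_mult2[OF WT mult_carrier_mat[OF A W(1)], of 0] col_mult2[OF A W(1), of 0] n by simp
    also have "\<dots> = e \<cdot>\<^sub>v (W\<^sup>T *\<^sub>v col W 0)" unfolding Av using WT v W by (simp add: mult_mat_vec[OF WT])
    also have "W\<^sup>T *\<^sub>v col W 0 = col (1\<^sub>m n) 0"
      using col_mult2[OF WT W(1), of 0] n W(2) by simp
    finally have "col A' 0 $ i = (e \<cdot>\<^sub>v col (1\<^sub>m n) 0) $ i" by simp
    then show ?thesis using i A' n by simp
  qed
  define A3 where "A3 = mat m m (\<lambda>(i,j). A' $$ (Suc i, Suc j))"
  have A3: "A3 \<in> carrier_mat m m" by (simp add: A3_def)
  have sym: "A' $$ (i, j) = A' $$ (j, i)" if "i < n" "j < n" for i j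
    using arg_cong[OF A'T, of "\<lambda>B. B $$ (i,j)"] that A' by simp
  have row0: "A' $$ (0, i) = (if i = 0 then e else 0)" if "i < n" for i
    using sym[OF _ that, of 0] col0[OF that] n by simp
  have block: "A' = four_block_mat (mat 1 1 (\<lambda>_. e)) (0\<^sub>m 1 m) (0\<^sub>m m 1) A3"
    by (rule eq_matI) (use A' n in \<open>auto simp: A3_def row0 col0\<close>)
  have A3T: "A3\<^sup>T = A3"
    by (rule eq_matI) (use n in \<open>auto simp: A3_def intro: sym\<close>)
  have "[:- e, 1:] * (\<Prod>e\<leftarrow>es. [:- e, 1:]) = char_poly A'"
    using cp char_poly_similar[of A A'] sim unfolding similar_mat_def by auto
  also have "\<dots> = char_poly (mat 1 1 (\<lambda>_. e)) * char_poly A3"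
    unfolding block by (rule char_poly_four_block_zeros_col) (auto simp: A3)
  also have "char_poly (mat 1 1 (\<lambda>_. e)) = [:- e, 1:]"
    by (simp add: char_poly_defs det_def sign_def)
  finally have "char_poly A3 = (\<Prod>e\<leftarrow>es. [:- e, 1:])"
    by (metis mult_cancel_left pCons_eq_0_iff zero_neq_one)
  from Cons(1)[OF A3 A3T this] obtain V where
    V: "similar_mat_wit A3 (mat_diag m ((!) es)) V (V\<^sup>T)" by blast
  from similar_mat_witD2[OF A3 V] have Vc: "V \<in> carrier_mat m m" by auto
  define P where "P = four_block_mat (1\<^sub>m 1) (0\<^sub>m 1 m) (0\<^sub>m m 1) V"
  have P: "P \<in> carrier_mat n n" using four_block_carrier_mat[OF one_carrier_mat[of 1] Vc] n by (simp add: P_def)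
  have PT: "P\<^sup>T = four_block_mat (1\<^sub>m 1) (0\<^sub>m 1 m) (0\<^sub>m m 1) (V\<^sup>T)"
    unfolding P_def by (subst transpose_four_block_mat[of _ 1 1 _ m _ m]) (use Vc in auto)
  have diag: "mat_diag n ((!) (e # es)) = four_block_mat (mat 1 1 (\<lambda>_. e)) (0\<^sub>m 1 m) (0\<^sub>m m 1) (mat_diag m ((!) es))"
    by (rule eq_matI) (use n in \<open>auto simp: mat_diag_def nth_Cons'\<close>)
  have "similar_mat_wit A' (mat_diag n ((!) (e # es))) P (P\<^sup>T)"
    unfolding PT unfolding diag P_def block
    by (rule similar_mat_wit_four_block[OF similar_mat_wit_refl V _ _ _ A3])
      (use Vc in auto)
  from similar_mat_wit_trans[OF sim this]
  show ?case using transpose_mult[OF W(1) P] by metis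
qed

lemma exists_nontrivial_homogeneous_solution:
  fixes c :: "nat \<Rightarrow> nat \<Rightarrow> real"
  assumes "r < n"
  shows "\<exists>s. (\<exists>j<n. s j \<noteq> 0) \<and> (\<forall>m<r. (\<Sum>j<n. c m j * s j) = 0)"
proof -
  define A where "A = mat n n (\<lambda>(i,j). if i < r then c i j else 0)"
  have A: "A \<in> carrier_mat n n" by (simp add: A_def)
  have "det A = (\<Sum>j<n. A $$ (r, j) * cofactor A r j)"
    by (rule laplace_expansion_row[OF A assms])
  also have "\<dots> = 0" using assms by (simp add: A_def)
  finally have "det A = 0" .
  then obtain v where v: "v \<in> carrier_vec n" "v \<noteq> 0\<^sub>v n" "A *\<^sub>v v = 0\<^sub>v n"
    unfolding det_0_iff_vec_prod_zero_field[OF A] by blast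
  have "\<exists>j<n. v $ j \<noteq> 0" using v by (metis eq_vecI carrier_vecD index_zero_vec)
  moreover have "(\<Sum>j<n. c m j * v $ j) = 0" if "m < r" for m
  proof -
    have "(A *\<^sub>v v) $ m = (\<Sum>j<n. c m j * v $ j)"
      using that assms v(1) by (simp add: A_def scalar_prod_def lessThan_atLeast0)
    then show ?thesis using v(3) that assms by simp
  qed
  ultimately show ?thesis by blast
qed

section \<open>Orthonormal frames and a diagonal quadratic form\<close>

lemma sum_Cauchy_Schwarz:
  fixes a b :: "'i \<Rightarrow> real"
  shows "(\<Sum>i\<in>I. a i * b i)\<^sup>2 \<le> (\<Sum>i\<in>I. (a i)\<^sup>2) * (\<Sum>i\<in>I. (b i)\<^sup>2)"
proof -
  have "0 \<le> (\<Sum>i\<in>I. \<Sum>j\<in>I. (a i * b j - a j * b i)\<^sup>2)"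
    by (intro sum_nonneg) auto
  also have "\<dots> = (\<Sum>i\<in>I. \<Sum>j\<in>I. (a i)\<^sup>2 * (b j)\<^sup>2 + (b i)\<^sup>2 * (a j)\<^sup>2 - 2 * ((a i * b i) * (a j * b j)))"
    by (intro sum.cong refl) (simp add: power2_eq_square algebra_simps)
  also have "\<dots> = 2 * ((\<Sum>i\<in>I. (a i)\<^sup>2) * (\<Sum>i\<in>I. (b i)\<^sup>2)) - 2 * (\<Sum>i\<in>I. a i * b i)\<^sup>2"
    by (simp add: sum.distrib sum_subtractf sum_distrib_left[symmetric] sum_distrib_right[symmetric]
        power2_eq_square[of "sum _ _"])
  finally show ?thesis by simp
qed

text \<open>Vectors of length \<open>n\<close> are functions on \<open>nat\<close> of which only the values below \<open>n\<close> matter.\<close>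

definition ip :: "nat \<Rightarrow> (nat \<Rightarrow> real) \<Rightarrow> (nat \<Rightarrow> real) \<Rightarrow> real" where
  "ip n f g = (\<Sum>m<n. f m * g m)"

lemma ip_commute: "ip n f g = ip n g f"
  by (simp add: ip_def mult.commute)

lemma ip_nonneg: "0 \<le> ip n f f"
  by (simp add: ip_def sum_nonneg)

lemma ip_zero [simp]: "ip n f (\<lambda>m. 0) = 0" "ip n (\<lambda>m. 0) f = 0"
  by (simp_all add: ip_def)

lemma ip_add_left: "ip n (\<lambda>m. f m + g m) h = ip n f h + ip n g h"
  and ip_diff_left: "ip n (\<lambda>m. f m - g m) h = ip n f h - ip n g h"
  and ip_scale_left: "ip n (\<lambda>m. c * f m) h = c * ip n f h"
  and ip_uminus_left: "ip n (\<lambda>m. - f m) h = - ip n f h"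
  and ip_sum_left: "ip n (\<lambda>m. \<Sum>i\<in>I. F i m) h = (\<Sum>i\<in>I. ip n (F i) h)"
  by (simp_all add: ip_def algebra_simps sum.distrib sum_subtractf sum_distrib_left sum_negf
      sum.swap[of _ I])

lemma ip_add_right: "ip n h (\<lambda>m. f m + g m) = ip n h f + ip n h g"
  and ip_diff_right: "ip n h (\<lambda>m. f m - g m) = ip n h f - ip n h g"
  and ip_scale_right: "ip n h (\<lambda>m. c * f m) = c * ip n h f"
  and ip_uminus_right: "ip n h (\<lambda>m. - f m) = - ip n h f"
  and ip_sum_right: "ip n h (\<lambda>m. \<Sum>i\<in>I. F i m) = (\<Sum>i\<in>I. ip n h (F i))"
  by (simp_all add: ip_commute[of n h] ip_add_left ip_diff_left ip_scale_left ip_uminus_left ip_sum_left)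

lemmas ip_bilinear =
  ip_add_left ip_diff_left ip_scale_left ip_uminus_left ip_sum_left
  ip_add_right ip_diff_right ip_scale_right ip_uminus_right ip_sum_right

lemma ip_Cauchy_Schwarz: "(ip n f g)\<^sup>2 \<le> ip n f f * ip n g g"
  using sum_Cauchy_Schwarz[of f g "{..<n}"] by (simp add: ip_def power2_eq_square)

lemma ip_eq_0_iff: "ip n f f = 0 \<longleftrightarrow> (\<forall>m<n. f m = 0)"
  unfolding ip_def by (subst sum_nonneg_eq_0_iff) auto

lemma member_le_ip:
  assumes "m < n" shows "(f m)\<^sup>2 \<le> ip n f f"
  unfolding ip_def using member_le_sum[of m "{..<n}" "\<lambda>m. f m * f m"] assms
  by (simp add: power2_eq_square)

locale orthonormal_frame =
  fixes N r :: nat and l :: "nat \<Rightarrow> real" and x :: "nat \<Rightarrow> nat \<Rightarrow> real"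
  assumes orth: "\<And>i j. i < r \<Longrightarrow> j < r \<Longrightarrow> ip N (x i) (x j) = (if i = j then 1 else 0)"
begin

text \<open>
  For \<open>M = diag(l)\<close> and \<open>X\<close> with columns \<open>x j\<close>: \<open>A\<close> is the matrix \<open>X\<^sup>T M X\<close>, \<open>rq j\<close> the Rayleigh quotient
  and \<open>res j\<close> the residual of \<open>x j\<close>, \<open>perp\<close> the projection orthogonal to the frame and \<open>wt\<close> the diagonal of
  \<open>N\<close>. A matrix \<open>U\<close> is given by its columns \<open>u j\<close>, and \<open>total u\<close> is its squared Frobenius norm.
\<close>

definition q :: "(nat \<Rightarrow> real) \<Rightarrow> (nat \<Rightarrow> real) \<Rightarrow> real" where
  "q f g = ip N (\<lambda>m. l m * f m) g"

definition A :: "nat \<Rightarrow> nat \<Rightarrow> real" where "A i j = q (x i) (x j)"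

definition rq :: "nat \<Rightarrow> real" where "rq j = A j j"

definition res :: "nat \<Rightarrow> nat \<Rightarrow> real" where "res j m = (l m - rq j) * x j m"

definition perp :: "(nat \<Rightarrow> real) \<Rightarrow> nat \<Rightarrow> real" where
  "perp f m = f m - (\<Sum>i<r. ip N (x i) f * x i m)"

definition wt :: "nat \<Rightarrow> real" where "wt j = real (r - j)"

definition hess :: "(nat \<Rightarrow> nat \<Rightarrow> real) \<Rightarrow> real" where
  "hess u = (\<Sum>j<r. wt j * ((\<Sum>i<r. A i j * ip N (u i) (u j)) - q (u j) (u j)))"

definition grad :: "nat \<Rightarrow> nat \<Rightarrow> real" where
  "grad j m = wt j * ((\<Sum>i<r. A i j * x i m) - l m * x j m)
      - 1/2 * (\<Sum>i<r. A i j * (wt j - wt i) * x i m)"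

definition tangent :: "(nat \<Rightarrow> nat \<Rightarrow> real) \<Rightarrow> bool" where
  "tangent u \<longleftrightarrow> (\<forall>i<r. \<forall>j<r. ip N (x i) (u j) + ip N (u i) (x j) = 0)"

definition total :: "(nat \<Rightarrow> nat \<Rightarrow> real) \<Rightarrow> real" where
  "total u = (\<Sum>j<r. ip N (u j) (u j))"

lemma q_commute: "q f g = q g f"
  by (simp add: q_def ip_def mult_ac)

lemma q_bilinear:
  "q (\<lambda>m. f m + g m) h = q f h + q g h"
  "q (\<lambda>m. f m - g m) h = q f h - q g h"
  "q (\<lambda>m. c * f m) h = c * q f h"
  "q (\<lambda>m. \<Sum>i\<in>I. F i m) h = (\<Sum>i\<in>I. q (F i) h)"
  "q h (\<lambda>m. f m + g m) = q h f + q h g"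
  "q h (\<lambda>m. f m - g m) = q h f - q h g"
  "q h (\<lambda>m. c * f m) = c * q h f"
  "q h (\<lambda>m. \<Sum>i\<in>I. F i m) = (\<Sum>i\<in>I. q h (F i))"
  by (simp_all add: q_def ip_bilinear distrib_left right_diff_distrib sum_distrib_left mult.left_commute[of _ c])

lemma A_commute: "A i j = A j i"
  by (simp add: A_def q_commute)

lemma q_frame: "q (x i) g = rq i * ip N (x i) g + ip N (res i) g"
  by (simp add: q_def res_def ip_def sum_distrib_left sum.distrib[symmetric] algebra_simps)

lemma ip_frame_sum:
  assumes "i < r" shows "ip N (x i) (\<lambda>m. \<Sum>j<r. s j * x j m) = s i"
proof -
  have "ip N (x i) (\<lambda>m. \<Sum>j<r. s j * x j m) = (\<Sum>j<r. if i = j then s j else 0)"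
    unfolding ip_bilinear by (rule sum.cong) (use assms in \<open>auto simp: orth\<close>)
  then show ?thesis using assms by simp
qed

lemma ip_frame_perp:
  assumes "i < r" shows "ip N (x i) (perp f) = 0"
  unfolding perp_def ip_diff_right ip_frame_sum[OF assms] by simp

lemma pythagoras:
  assumes "\<And>i. i < r \<Longrightarrow> ip N (x i) k = 0"
  shows "ip N (\<lambda>m. (\<Sum>i<r. s i * x i m) + k m) (\<lambda>m. (\<Sum>i<r. s i * x i m) + k m)
    = (\<Sum>i<r. (s i)\<^sup>2) + ip N k k"
proof -
  let ?p = "\<lambda>m. \<Sum>i<r. s i * x i m"
  have pk: "ip N ?p k = 0"
    unfolding ip_sum_left ip_scale_left using assms by simp
  have "ip N ?p ?p = (\<Sum>i<r. s i * ip N (x i) ?p)"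
    by (simp only: ip_sum_left ip_scale_left)
  also have "\<dots> = (\<Sum>i<r. (s i)\<^sup>2)"
    by (intro sum.cong refl) (simp add: ip_frame_sum power2_eq_square)
  finally have pp: "ip N ?p ?p = (\<Sum>i<r. (s i)\<^sup>2)" .
  show ?thesis
    unfolding ip_add_left ip_add_right pp ip_commute[of N k ?p] pk by simp
qed

lemma decompose: "f m = (\<Sum>i<r. ip N (x i) f * x i m) + perp f m"
  by (simp add: perp_def)

lemma ip_self_decomp: "ip N f f = (\<Sum>i<r. (ip N (x i) f)\<^sup>2) + ip N (perp f) (perp f)"
  using pythagoras[of "perp f" "\<lambda>i. ip N (x i) f", OF ip_frame_perp]
  unfolding decompose[symmetric] .

lemma bessel: "(\<Sum>i<r. (ip N (x i) f)\<^sup>2) \<le> ip N f f"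
  using ip_self_decomp[of f] ip_nonneg[of N "perp f"] by linarith

lemma q_frame_sum_plus:
  assumes k: "\<And>i. i < r \<Longrightarrow> ip N (x i) k = 0"
    and f: "\<And>m. f m = (\<Sum>i<r. s i * x i m) + k m"
  shows "q f f = (\<Sum>i<r. rq i * (s i)\<^sup>2) + q k k + (\<Sum>i<r. s i * ip N (res i) (\<lambda>m. f m + k m))"
proof -
  let ?p = "\<lambda>m. \<Sum>i<r. s i * x i m"
  have f': "f = (\<lambda>m. ?p m + k m)" using f by auto
  have xf: "ip N (x i) f = s i" if "i < r" for i
    unfolding f' ip_add_right ip_frame_sum[OF that] k[OF that] by simp
  have pg: "q ?p g = (\<Sum>i<r. s i * q (x i) g)" for g
    by (simp only: q_bilinear)
  have "q f f = q ?p f + q k f"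
    using q_bilinear(1)[of ?p k f] unfolding f'[symmetric] .
  also have "q k f = q k ?p + q k k"
    using q_bilinear(5)[of k ?p k] unfolding f'[symmetric] .
  also have "q k ?p = q ?p k" by (rule q_commute)
  finally have "q f f = (\<Sum>i<r. s i * q (x i) f) + (\<Sum>i<r. s i * q (x i) k) + q k k"
    unfolding pg by simp
  also have "(\<Sum>i<r. s i * q (x i) f) + (\<Sum>i<r. s i * q (x i) k)
      = (\<Sum>i<r. rq i * (s i)\<^sup>2 + s i * ip N (res i) (\<lambda>m. f m + k m))"
    unfolding sum.distrib[symmetric]
    by (intro sum.cong refl)
      (simp add: q_frame xf k ip_add_right power2_eq_square algebra_simps)
  finally show ?thesis by (simp add: sum.distrib)
qed

lemma A_eq_res:
  assumes "i < r" "j < r"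
  shows "A i j = (if i = j then rq j else 0) + ip N (res j) (x i)"
  using q_frame[of j "x i"] orth[OF assms(2,1)] A_commute[of i j]
  by (auto simp: A_def)

lemma res_orth_self:
  assumes "j < r" shows "ip N (res j) (x j) = 0"
  using A_eq_res[OF assms assms] by (simp add: rq_def)

lemma wt_bounds:
  assumes "j < r" shows "1 \<le> wt j" "wt j \<le> real r"
  using assms by (auto simp: wt_def of_nat_diff)

lemma wt_diff:
  assumes "i < r" "j < r" shows "wt i - wt j = real j - real i"
  using assms by (simp add: wt_def of_nat_diff)

lemma res_le_grad:
  assumes j: "j < r" shows "ip N (res j) (res j) \<le> 4 * ip N (grad j) (grad j)"
proof -
  let ?b = "perp (res j)"
  have coef: "ip N (x i) (res j) = (if i = j then 0 else A i j)" if "i < r" for i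
    using A_eq_res[OF that j] res_orth_self[OF j] by (auto simp: ip_commute)
  define c where "c i = - 1/2 * (A i j * (wt j - wt i))" for i
  have g: "grad j m = (\<Sum>i<r. c i * x i m) + (- wt j) * ?b m" for m
  proof -
    have "(\<Sum>i<r. A i j * x i m) = (\<Sum>i<r. (if i = j then rq j * x j m else 0) + ip N (x i) (res j) * x i m)"
      by (intro sum.cong refl) (simp add: coef rq_def)
    also have "\<dots> = rq j * x j m + (\<Sum>i<r. ip N (x i) (res j) * x i m)"
      using j by (simp add: sum.distrib)
    finally have "(\<Sum>i<r. A i j * x i m) - l m * x j m = - ?b m"
      by (simp add: perp_def res_def algebra_simps)
    moreover have "- (1/2) * (\<Sum>i<r. A i j * (wt j - wt i) * x i m) = (\<Sum>i<r. c i * x i m)"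
      unfolding sum_distrib_left by (intro sum.cong refl) (simp add: c_def)
    ultimately show ?thesis unfolding grad_def by simp
  qed
  have "ip N (grad j) (grad j) = (\<Sum>i<r. (c i)\<^sup>2) + ip N (\<lambda>m. - wt j * ?b m) (\<lambda>m. - wt j * ?b m)"
    using pythagoras[of "\<lambda>m. - wt j * ?b m" c]
    unfolding g[abs_def] by (simp add: ip_scale_right[of _ _ "- wt j", simplified] ip_uminus_right ip_frame_perp)
  also have "ip N (\<lambda>m. - wt j * ?b m) (\<lambda>m. - wt j * ?b m) = (wt j)\<^sup>2 * ip N ?b ?b"
    unfolding ip_scale_left ip_scale_right by (simp add: power2_eq_square)
  finally have G: "ip N (grad j) (grad j) = (\<Sum>i<r. (c i)\<^sup>2) + (wt j)\<^sup>2 * ip N ?b ?b" .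
  have "(\<Sum>i<r. (ip N (x i) (res j))\<^sup>2) \<le> (\<Sum>i<r. 4 * (c i)\<^sup>2)"
  proof (rule sum_mono)
    fix i assume "i \<in> {..<r}"
    then have i: "i < r" by simp
    show "(ip N (x i) (res j))\<^sup>2 \<le> 4 * (c i)\<^sup>2"
    proof (cases "i = j")
      case False
      have "1 \<le> \<bar>wt j - wt i\<bar>" using False unfolding wt_diff[OF j i] by linarith
      then have "1 \<le> (wt j - wt i)\<^sup>2" by (metis abs_le_square_iff abs_one one_power2)
      then have "(A i j)\<^sup>2 * 1 \<le> (A i j)\<^sup>2 * (wt j - wt i)\<^sup>2" by (intro mult_left_mono) auto
      then show ?thesis using False by (simp add: coef[OF i] c_def power_mult_distrib power_divide)
    qed (use coef[OF i] in simp)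
  qed
  moreover have "ip N ?b ?b * 1 \<le> ip N ?b ?b * (4 * (wt j)\<^sup>2)"
  proof (rule mult_left_mono)
    have "1 \<le> (wt j)\<^sup>2" using wt_bounds(1)[OF j] by (simp add: one_le_power)
    then show "1 \<le> 4 * (wt j)\<^sup>2" by simp
  qed (rule ip_nonneg)
  ultimately show ?thesis
    unfolding ip_self_decomp[of "res j"] G by (simp add: sum_distrib_left algebra_simps)
qed

definition main_part :: "(nat \<Rightarrow> nat \<Rightarrow> real) \<Rightarrow> real" where
  "main_part u = (\<Sum>j<r. wt j * (\<Sum>i<r. (rq j - rq i) * (ip N (x i) (u j))\<^sup>2))
     + (\<Sum>j<r. wt j * (rq j * ip N (perp (u j)) (perp (u j)) - q (perp (u j)) (perp (u j))))"

lemma hess_eq_main_part: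
  "hess u = main_part u + (\<Sum>j<r. \<Sum>i<r. ip N (res j) (x i) * (wt j * ip N (u i) (u j)))
     - (\<Sum>j<r. wt j * (\<Sum>i<r. ip N (x i) (u j) * ip N (res i) (\<lambda>m. u j m + perp (u j) m)))"
proof -
  have col: "(\<Sum>i<r. A i j * ip N (u i) (u j)) - q (u j) (u j)
     = (\<Sum>i<r. (rq j - rq i) * (ip N (x i) (u j))\<^sup>2)
       + (rq j * ip N (perp (u j)) (perp (u j)) - q (perp (u j)) (perp (u j)))
       + (\<Sum>i<r. ip N (res j) (x i) * ip N (u i) (u j))
       - (\<Sum>i<r. ip N (x i) (u j) * ip N (res i) (\<lambda>m. u j m + perp (u j) m))"
    if j: "j < r" for j
  proof -
    have "(\<Sum>i<r. A i j * ip N (u i) (u j))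
       = (\<Sum>i<r. (if i = j then rq j * ip N (u j) (u j) else 0) + ip N (res j) (x i) * ip N (u i) (u j))"
      by (intro sum.cong refl) (use j in \<open>auto simp: A_eq_res algebra_simps\<close>)
    also have "\<dots> = rq j * ip N (u j) (u j) + (\<Sum>i<r. ip N (res j) (x i) * ip N (u i) (u j))"
      using j by (simp add: sum.distrib)
    finally show ?thesis
      using q_frame_sum_plus[of "perp (u j)" "u j" "\<lambda>i. ip N (x i) (u j)", OF ip_frame_perp decompose]
      by (simp add: ip_self_decomp[of "u j"] algebra_simps sum_subtractf sum_distrib_left)
  qed
  have "hess u = (\<Sum>j<r. wt j * (\<Sum>i<r. (rq j - rq i) * (ip N (x i) (u j))\<^sup>2)
       + wt j * (rq j * ip N (perp (u j)) (perp (u j)) - q (perp (u j)) (perp (u j)))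
       + (\<Sum>i<r. ip N (res j) (x i) * (wt j * ip N (u i) (u j)))
       - wt j * (\<Sum>i<r. ip N (x i) (u j) * ip N (res i) (\<lambda>m. u j m + perp (u j) m)))"
    unfolding hess_def
  proof (intro sum.cong refl)
    fix j assume "j \<in> {..<r}"
    then have j: "j < r" by simp
    have w: "(\<Sum>i<r. ip N (res j) (x i) * (wt j * ip N (u i) (u j)))
       = wt j * (\<Sum>i<r. ip N (res j) (x i) * ip N (u i) (u j))"
      by (simp add: sum_distrib_left mult_ac)
    show "wt j * ((\<Sum>i<r. A i j * ip N (u i) (u j)) - q (u j) (u j)) =
       wt j * (\<Sum>i<r. (rq j - rq i) * (ip N (x i) (u j))\<^sup>2)
       + wt j * (rq j * ip N (perp (u j)) (perp (u j)) - q (perp (u j)) (perp (u j)))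
       + (\<Sum>i<r. ip N (res j) (x i) * (wt j * ip N (u i) (u j)))
       - wt j * (\<Sum>i<r. ip N (x i) (u j) * ip N (res i) (\<lambda>m. u j m + perp (u j) m))"
      unfolding w col[OF j] by (simp only: distrib_left right_diff_distrib)
  qed
  then show ?thesis by (simp add: main_part_def sum.distrib sum_subtractf)
qed

end

locale small_residual_frame = orthonormal_frame +
  fixes \<delta> :: real
  assumes \<delta>_nonneg: "0 \<le> \<delta>"
    and res_small: "(\<Sum>j<r. ip N (res j) (res j)) \<le> \<delta>\<^sup>2"
begin

lemma sum_coeff_res_bound:
  assumes s: "(\<Sum>i<r. (s i)\<^sup>2) \<le> a\<^sup>2" and g: "ip N g g \<le> b\<^sup>2" and "0 \<le> a" "0 \<le> b"
  shows "\<bar>\<Sum>i<r. s i * ip N (res i) g\<bar> \<le> a * b * \<delta>"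
proof -
  have "(\<Sum>i<r. (ip N (res i) g)\<^sup>2) \<le> (\<Sum>i<r. ip N (res i) (res i) * ip N g g)"
    by (intro sum_mono ip_Cauchy_Schwarz)
  also have "\<dots> \<le> \<delta>\<^sup>2 * b\<^sup>2"
    unfolding sum_distrib_right[symmetric] using res_small g
    by (intro mult_mono) (auto simp: ip_nonneg)
  finally have "(\<Sum>i<r. (s i)\<^sup>2) * (\<Sum>i<r. (ip N (res i) g)\<^sup>2) \<le> a\<^sup>2 * (\<delta>\<^sup>2 * b\<^sup>2)"
    using s by (intro mult_mono) (auto intro: sum_nonneg)
  then have "(\<Sum>i<r. s i * ip N (res i) g)\<^sup>2 \<le> (a * b * \<delta>)\<^sup>2"
    using sum_Cauchy_Schwarz[of s "\<lambda>i. ip N (res i) g" "{..<r}"]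
    by (simp add: power_mult_distrib mult_ac)
  moreover have "0 \<le> a * b * \<delta>" using assms \<delta>_nonneg by simp
  ultimately show ?thesis by (simp add: abs_le_square_iff[symmetric])
qed

lemma q_error_bound:
  assumes k: "\<And>i. i < r \<Longrightarrow> ip N (x i) k = 0"
    and f: "\<And>m. f m = (\<Sum>i<r. s i * x i m) + k m"
  shows "\<bar>\<Sum>i<r. s i * ip N (res i) (\<lambda>m. f m + k m)\<bar> \<le> 2 * \<delta> * ip N f f"
proof -
  have ff: "ip N f f = (\<Sum>i<r. (s i)\<^sup>2) + ip N k k"
    using pythagoras[OF k, of s] unfolding f[symmetric] .
  have fk: "ip N (\<lambda>m. f m + k m) (\<lambda>m. f m + k m) + ip N (\<lambda>m. f m - k m) (\<lambda>m. f m - k m)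
      = 2 * ip N f f + 2 * ip N k k"
    by (simp add: ip_bilinear)
  have kk: "ip N k k \<le> ip N f f" unfolding ff by (simp add: sum_nonneg)
  have "\<bar>\<Sum>i<r. s i * ip N (res i) (\<lambda>m. f m + k m)\<bar> \<le> sqrt (ip N f f) * (2 * sqrt (ip N f f)) * \<delta>"
  proof (rule sum_coeff_res_bound)
    show "(\<Sum>i<r. (s i)\<^sup>2) \<le> (sqrt (ip N f f))\<^sup>2"
      using ip_nonneg[of N k] by (simp add: ip_nonneg) (simp add: ff ip_nonneg)
    show "ip N (\<lambda>m. f m + k m) (\<lambda>m. f m + k m) \<le> (2 * sqrt (ip N f f))\<^sup>2"
    proof -
      have "ip N (\<lambda>m. f m + k m) (\<lambda>m. f m + k m) \<le> 4 * ip N f f"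
        using fk kk ip_nonneg[of N "\<lambda>m. f m - k m"] by linarith
      then show ?thesis by (simp add: power_mult_distrib ip_nonneg)
    qed
  qed (auto simp: ip_nonneg)
  also have "\<dots> = 2 * \<delta> * ip N f f" using ip_nonneg[of N f] by simp
  finally show ?thesis .
qed

lemma hess_main_part_bound: "\<bar>hess u - main_part u\<bar> \<le> 3 * real r * \<delta> * total u"
proof -
  let ?E1 = "\<Sum>j<r. \<Sum>i<r. ip N (res j) (x i) * (wt j * ip N (u i) (u j))"
  let ?e2 = "\<lambda>j. \<Sum>i<r. ip N (x i) (u j) * ip N (res i) (\<lambda>m. u j m + perp (u j) m)"
  have T: "0 \<le> total u" by (simp add: total_def sum_nonneg ip_nonneg)
  have "?E1\<^sup>2 \<le> (\<Sum>j<r. \<Sum>i<r. (ip N (res j) (x i))\<^sup>2) * (\<Sum>j<r. \<Sum>i<r. (wt j * ip N (u i) (u j))\<^sup>2)"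
    using sum_Cauchy_Schwarz[of "\<lambda>(j,i). ip N (res j) (x i)" "\<lambda>(j,i). wt j * ip N (u i) (u j)"
        "{..<r} \<times> {..<r}"]
    by (simp add: sum.cartesian_product split_def)
  also have "\<dots> \<le> \<delta>\<^sup>2 * ((real r)\<^sup>2 * (total u)\<^sup>2)"
  proof (rule mult_mono)
    have "(\<Sum>j<r. \<Sum>i<r. (ip N (res j) (x i))\<^sup>2) \<le> (\<Sum>j<r. ip N (res j) (res j))"
      using bessel by (intro sum_mono) (simp only: ip_commute[of N "res _" "x _"])
    then show "(\<Sum>j<r. \<Sum>i<r. (ip N (res j) (x i))\<^sup>2) \<le> \<delta>\<^sup>2" using res_small by linarith
    have "(\<Sum>j<r. \<Sum>i<r. (wt j * ip N (u i) (u j))\<^sup>2)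
        \<le> (\<Sum>j<r. \<Sum>i<r. (real r)\<^sup>2 * (ip N (u i) (u i) * ip N (u j) (u j)))"
    proof (intro sum_mono)
      fix i j assume "i \<in> {..<r}" "j \<in> {..<r}"
      then have "(wt j)\<^sup>2 \<le> (real r)\<^sup>2" using wt_bounds[of j] by (intro power_mono) auto
      then show "(wt j * ip N (u i) (u j))\<^sup>2 \<le> (real r)\<^sup>2 * (ip N (u i) (u i) * ip N (u j) (u j))"
        unfolding power_mult_distrib by (intro mult_mono ip_Cauchy_Schwarz) auto
    qed
    also have "\<dots> = (real r)\<^sup>2 * (total u)\<^sup>2"
      unfolding total_def power2_eq_square[of "sum _ _"]
      by (simp add: sum_distrib_left sum_distrib_right mult_ac)
    finally show "(\<Sum>j<r. \<Sum>i<r. (wt j * ip N (u i) (u j))\<^sup>2) \<le> (real r)\<^sup>2 * (total u)\<^sup>2" .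
  qed (auto intro!: sum_nonneg)
  finally have "?E1\<^sup>2 \<le> (real r * \<delta> * total u)\<^sup>2" by (simp add: power_mult_distrib mult_ac)
  moreover have "0 \<le> real r * \<delta> * total u" using T \<delta>_nonneg by simp
  ultimately have E1: "\<bar>?E1\<bar> \<le> real r * \<delta> * total u" by (simp add: abs_le_square_iff[symmetric])
  have "\<bar>\<Sum>j<r. wt j * ?e2 j\<bar> \<le> (\<Sum>j<r. real r * (2 * \<delta> * ip N (u j) (u j)))"
  proof (rule order_trans[OF sum_abs], rule sum_mono)
    fix j assume "j \<in> {..<r}"
    then have j: "j < r" by simp
    show "\<bar>wt j * ?e2 j\<bar> \<le> real r * (2 * \<delta> * ip N (u j) (u j))"
      unfolding abs_mult
      using wt_bounds[OF j] q_error_bound[of "perp (u j)" "u j" "\<lambda>i. ip N (x i) (u j)", OF ip_frame_perp decompose]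
      by (intro mult_mono) auto
  qed
  also have "\<dots> = 2 * real r * \<delta> * total u" by (simp add: total_def sum_distrib_left mult_ac)
  finally have E2: "\<bar>\<Sum>j<r. wt j * ?e2 j\<bar> \<le> 2 * real r * \<delta> * total u" .
  have "hess u - main_part u = ?E1 - (\<Sum>j<r. wt j * ?e2 j)"
    using hess_eq_main_part[of u] by simp
  then show ?thesis using E1 E2 by (simp add: abs_le_iff)
qed

end

context orthonormal_frame
begin

lemma perp_eq_self:
  assumes "\<And>i. i < r \<Longrightarrow> ip N (x i) k = 0"
  shows "perp k = k"
  by (rule ext) (simp add: perp_def assms)

lemma perp_frame:
  assumes "i < r" shows "perp (\<lambda>m. c * x i m) = (\<lambda>m. 0)"
proof (rule ext)
  fix m
  have "(\<Sum>j<r. ip N (x j) (\<lambda>m. c * x i m) * x j m) = (\<Sum>j<r. if j = i then c * x i m else 0)"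
    by (rule sum.cong) (use assms in \<open>auto simp: ip_scale_right orth\<close>)
  then show "perp (\<lambda>m. c * x i m) m = 0" using assms by (simp add: perp_def)
qed

lemma q_zero [simp]: "q (\<lambda>m. 0) g = 0" "q g (\<lambda>m. 0) = 0"
  by (simp_all add: q_def)

lemma perp_zero [simp]: "perp (\<lambda>m. 0) = (\<lambda>m. 0)"
  by (simp add: perp_def fun_eq_iff)

lemma row_norm_le_1:
  assumes "m < N" shows "(\<Sum>j<r. (x j m)\<^sup>2) \<le> 1"
proof -
  let ?v = "\<lambda>k. if k = m then 1 else 0 :: real"
  have "ip N f ?v = f m" for f
    using assms by (simp add: ip_def if_distrib[of "(*) _"] cong: if_cong)
  then show ?thesis using bessel[of ?v] by simp
qed

lemma hess_scale: "hess (\<lambda>j m. c * u j m) = c\<^sup>2 * hess u"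
  by (simp add: hess_def ip_scale_left ip_scale_right q_bilinear sum_distrib_left power2_eq_square algebra_simps)

lemma total_scale: "total (\<lambda>j m. c * u j m) = c\<^sup>2 * total u"
  by (simp add: total_def ip_scale_left ip_scale_right sum_distrib_left power2_eq_square algebra_simps)

lemma tangent_scale: "tangent u \<Longrightarrow> tangent (\<lambda>j m. c * u j m)"
  unfolding tangent_def ip_scale_left ip_scale_right distrib_left[symmetric] by simp

lemma total_nonneg: "0 \<le> total u"
  by (simp add: total_def sum_nonneg ip_nonneg)

lemma
  assumes k: "\<And>i. i < r \<Longrightarrow> ip N (x i) k = 0" and j: "j < r"
  defines "u \<equiv> (\<lambda>i. if i = j then k else (\<lambda>m. 0))"
  shows tangent_column: "tangent u"
    and total_column: "total u = ip N k k"
    and main_part_column: "main_part u = wt j * (rq j * ip N k k - q k k)"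
proof -
  have xu: "ip N (x i) (u a) = 0" if "i < r" for i a
    using k[OF that] by (simp add: u_def)
  then have "ip N (u a) (x i) = 0" if "i < r" for i a
    using that by (simp add: ip_commute[of N "u a"])
  with xu show "tangent u" by (simp add: tangent_def)
  have "total u = (\<Sum>a<r. if a = j then ip N k k else 0)"
    unfolding total_def by (intro sum.cong) (auto simp: u_def)
  then show "total u = ip N k k" using j by simp
  have "main_part u = (\<Sum>a<r. wt a * (rq a * ip N (u a) (u a) - q (u a) (u a)))"
    using perp_eq_self[OF xu] by (simp add: main_part_def xu)
  also have "\<dots> = (\<Sum>a<r. if a = j then wt j * (rq j * ip N k k - q k k) else 0)"
    by (intro sum.cong) (auto simp: u_def)
  finally show "main_part u = wt j * (rq j * ip N k k - q k k)" using j by simp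
qed

lemma
  assumes i: "i < r" and j: "j < r" and ij: "i \<noteq> j"
  defines "u \<equiv> (\<lambda>a m. if a = i then - 1 * x j m else if a = j then 1 * x i m else 0)"
  shows tangent_rotation: "tangent u"
    and total_rotation: "total u = 2"
    and main_part_rotation: "main_part u = (wt i - wt j) * (rq i - rq j)"
proof -
  have ui: "u i = (\<lambda>m. - 1 * x j m)" and uj: "u j = (\<lambda>m. 1 * x i m)"
    and u0: "a \<noteq> i \<Longrightarrow> a \<noteq> j \<Longrightarrow> u a = (\<lambda>m. 0)" for a
    using ij by (auto simp: u_def)
  have xu: "ip N (x b) (u a) = (if a = i \<and> b = j then -1 else if a = j \<and> b = i then 1 else 0)"
    if "b < r" for a b
    using that i j ij ip_scale_right[of N "x b" "-1" "x j"] ip_scale_right[of N "x b" 1 "x i"]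
    by (cases "a = i"; cases "a = j") (auto simp: ui uj u0 orth)
  have ux: "ip N (u a) (x b) = ip N (x b) (u a)" for a b by (rule ip_commute)
  show "tangent u" unfolding tangent_def ux using ij by (auto simp: xu)
  have perp0: "perp (u a) = (\<lambda>m. 0)" for a
    using perp_frame[OF j, of "-1"] perp_frame[OF i, of 1]
    by (cases "a = i"; cases "a = j") (simp_all only: ui uj u0 perp_zero not_False_eq_True)
  have "total u = (\<Sum>a<r. (if a = i then 1 else 0) + (if a = j then 1 else 0))"
    unfolding total_def ip_self_decomp[of "u _"] perp0
  proof (intro sum.cong refl)
    fix a
    have "(\<Sum>b<r. (ip N (x b) (u a))\<^sup>2)
      = (\<Sum>b<r. (if b = j then (if a = i then 1 else 0) else 0) + (if b = i then (if a = j then 1 else 0) else 0))"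
      by (intro sum.cong) (use ij in \<open>auto simp: xu\<close>)
    then show "(\<Sum>b<r. (ip N (x b) (u a))\<^sup>2) + ip N (\<lambda>m. 0) (\<lambda>m. 0)
      = (if a = i then 1 else 0) + (if a = j then 1 else 0)"
      using i j by (simp add: sum.distrib)
  qed
  then show "total u = 2" using i j by (simp add: sum.distrib)
  have "main_part u = (\<Sum>a<r. (if a = i then wt i * (rq i - rq j) else 0) + (if a = j then wt j * (rq j - rq i) else 0))"
    unfolding main_part_def perp0 ip_zero q_zero
  proof (simp only: mult_zero_right diff_zero sum.neutral_const add_0_right, intro sum.cong refl)
    fix a
    have "(\<Sum>b<r. (rq a - rq b) * (ip N (x b) (u a))\<^sup>2)
      = (\<Sum>b<r. (if b = j then (if a = i then rq i - rq j else 0) else 0) + (if b = i then (if a = j then rq j - rq i else 0) else 0))"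
      by (intro sum.cong) (use ij in \<open>auto simp: xu\<close>)
    then show "wt a * (\<Sum>b<r. (rq a - rq b) * (ip N (x b) (u a))\<^sup>2)
      = (if a = i then wt i * (rq i - rq j) else 0) + (if a = j then wt j * (rq j - rq i) else 0)"
      using i j by (auto simp: sum.distrib)
  qed
  also have "\<dots> = (wt i - wt j) * (rq i - rq j)"
    using i j by (simp add: sum.distrib algebra_simps)
  finally show "main_part u = (wt i - wt j) * (rq i - rq j)" .
qed

end

section \<open>Curvature under a spectral gap\<close>

locale gap_frame = small_residual_frame +
  fixes d :: real
  assumes d_pos: "0 < d" and r_pos: "1 \<le> r" and r_less: "r < N"
    and \<delta>_eq: "36 * real r * \<delta> = d"
    and gap: "\<And>s t. s < t \<Longrightarrow> t \<le> r \<Longrightarrow> d \<le> l s - l t"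
    and tail: "\<And>t. r \<le> t \<Longrightarrow> t < N \<Longrightarrow> l t \<le> l r"
begin

lemma \<delta>_le: "36 * \<delta> \<le> d"
proof -
  have "36 * \<delta> * 1 \<le> 36 * \<delta> * real r"
    using \<delta>_nonneg r_pos by (intro mult_left_mono) auto
  then show ?thesis using \<delta>_eq by (simp add: mult_ac)
qed

lemma gap_abs:
  assumes "s < r" "t < N" "s \<noteq> t" shows "d \<le> \<bar>l s - l t\<bar>"
proof (cases "t < r")
  case True
  then show ?thesis using gap[of s t] gap[of t s] assms by (cases "s < t") auto
next
  case False
  then show ?thesis using gap[of s r] tail[of t] assms by auto
qed

lemma res_col_small:
  assumes "j < r" shows "ip N (res j) (res j) \<le> \<delta>\<^sup>2"
  using member_le_sum[of j "{..<r}" "\<lambda>j. ip N (res j) (res j)"] res_small assms ip_nonneg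
  by (meson finite_lessThan lessThan_iff order_trans)

lemma sq_ineq: "1225 * \<delta>\<^sup>2 \<le> (d - \<delta>)\<^sup>2"
proof -
  have "(35 * \<delta>)\<^sup>2 \<le> (d - \<delta>)\<^sup>2"
    using \<delta>_le \<delta>_nonneg by (intro power_mono) auto
  then show ?thesis by (simp add: power_mult_distrib)
qed

lemma sq_pos: "0 < (d - \<delta>)\<^sup>2"
  using \<delta>_le d_pos by auto

lemma far_coord:
  assumes "d - \<delta> \<le> \<bar>rq j - l m\<bar>"
  shows "(d - \<delta>)\<^sup>2 * (x j m)\<^sup>2 \<le> (res j m)\<^sup>2"
proof -
  have "(d - \<delta>)\<^sup>2 \<le> \<bar>rq j - l m\<bar>\<^sup>2" using assms \<delta>_le d_pos by (intro power_mono) auto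
  then show ?thesis
    unfolding res_def power_mult_distrib by (intro mult_right_mono) (auto simp: power2_commute)
qed

lemma nearby_eigenvalue:
  assumes j: "j < r" shows "\<exists>m<N. \<bar>rq j - l m\<bar> \<le> \<delta>"
proof (rule ccontr)
  assume "\<not> ?thesis"
  then have far: "\<delta> < \<bar>rq j - l m\<bar>" if "m < N" for m using that by force
  then have pos: "0 < (l m - rq j)\<^sup>2 - \<delta>\<^sup>2" if "m < N" for m
    using power_strict_mono[OF far[OF that] \<delta>_nonneg, of 2] by (simp add: power2_commute)
  have xx: "(\<Sum>m<N. (x j m)\<^sup>2) = 1" using orth[OF j j] by (simp add: ip_def power2_eq_square)
  have "(\<Sum>m<N. ((l m - rq j)\<^sup>2 - \<delta>\<^sup>2) * (x j m)\<^sup>2) = ip N (res j) (res j) - \<delta>\<^sup>2 * (\<Sum>m<N. (x j m)\<^sup>2)"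
    by (simp add: ip_def res_def sum_distrib_left sum_subtractf[symmetric] power2_eq_square algebra_simps)
  also have "\<dots> \<le> 0" using res_col_small[OF j] xx by simp
  finally have "(\<Sum>m<N. ((l m - rq j)\<^sup>2 - \<delta>\<^sup>2) * (x j m)\<^sup>2) = 0"
    using pos by (intro antisym sum_nonneg mult_nonneg_nonneg) (auto simp: less_eq_real_def)
  then have "\<forall>m\<in>{..<N}. ((l m - rq j)\<^sup>2 - \<delta>\<^sup>2) * (x j m)\<^sup>2 = 0"
    using pos by (subst (asm) sum_nonneg_eq_0_iff) (auto simp: less_eq_real_def intro!: mult_nonneg_nonneg)
  then have "x j m = 0" if "m < N" for m using pos[OF that] that by force
  then show False using xx by simp
qed

lemma concentrated_coord:
  assumes j: "j < r" and m: "m < r" and near: "\<bar>rq j - l m\<bar> \<le> \<delta>"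
  shows "1/2 < (x j m)\<^sup>2"
proof -
  have mN: "m < N" using m r_less by simp
  have xx: "(\<Sum>m<N. (x j m)\<^sup>2) = 1" using orth[OF j j] by (simp add: ip_def power2_eq_square)
  then have "1 - (x j m)\<^sup>2 = (\<Sum>k\<in>{..<N} - {m}. (x j k)\<^sup>2)"
    using mN by (simp add: sum_diff1)
  then have "(d - \<delta>)\<^sup>2 * (1 - (x j m)\<^sup>2) = (\<Sum>k\<in>{..<N} - {m}. (d - \<delta>)\<^sup>2 * (x j k)\<^sup>2)"
    by (simp add: sum_distrib_left)
  also have "\<dots> \<le> (\<Sum>k\<in>{..<N} - {m}. (res j k)\<^sup>2)"
  proof (intro sum_mono far_coord)
    fix k assume "k \<in> {..<N} - {m}"
    then show "d - \<delta> \<le> \<bar>rq j - l k\<bar>" using gap_abs[OF m, of k] near by auto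
  qed
  also have "\<dots> \<le> (\<Sum>k<N. (res j k)\<^sup>2)" by (rule sum_mono2) auto
  also have "\<dots> \<le> \<delta>\<^sup>2" using res_col_small[OF j] by (simp add: ip_def power2_eq_square)
  finally have "1225 * ((d - \<delta>)\<^sup>2 * (1 - (x j m)\<^sup>2)) \<le> (d - \<delta>)\<^sup>2" using sq_ineq by linarith
  then have "(d - \<delta>)\<^sup>2 * (1225 * (1 - (x j m)\<^sup>2)) \<le> (d - \<delta>)\<^sup>2 * 1" by (simp add: mult_ac)
  then have "1225 * (1 - (x j m)\<^sup>2) \<le> 1" using sq_pos by (simp only: mult_le_cancel_left_pos)
  then show ?thesis by simp
qed

lemma nearby_inj:
  assumes "i < r" "j < r" "m < r" "\<bar>rq i - l m\<bar> \<le> \<delta>" "\<bar>rq j - l m\<bar> \<le> \<delta>"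
  shows "i = j"
proof (rule ccontr)
  assume "i \<noteq> j"
  have "(x i m)\<^sup>2 + (x j m)\<^sup>2 = (\<Sum>a\<in>{i,j}. (x a m)\<^sup>2)" using \<open>i \<noteq> j\<close> by simp
  also have "\<dots> \<le> (\<Sum>a<r. (x a m)\<^sup>2)" using assms by (intro sum_mono2) auto
  also have "\<dots> \<le> 1" using assms r_less by (intro row_norm_le_1) simp
  finally show False
    using concentrated_coord[of i m] concentrated_coord[of j m] assms by simp
qed

lemma negative_perp_direction:
  assumes j: "j < r" and m: "m < r" and low: "rq j \<le> l r + \<delta>"
    and far: "\<And>i. i < r \<Longrightarrow> d - \<delta> \<le> \<bar>rq i - l m\<bar>"
  shows "\<exists>u. tangent u \<and> 0 < total u \<and> hess u \<le> - (11/100 * d * total u)"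
proof -
  have mN: "m < N" using m r_less by simp
  define v where "v = (\<lambda>k. if k = m then 1 else 0 :: real)"
  define k where "k = perp v"
  have ipv: "ip N f v = f m" for f
    using mN by (simp add: v_def ip_def if_distrib[of "(*) _"] cong: if_cong)
  have k: "ip N (x i) k = 0" if "i < r" for i unfolding k_def by (rule ip_frame_perp[OF that])
  have "(\<Sum>i<r. (d - \<delta>)\<^sup>2 * (x i m)\<^sup>2) \<le> (\<Sum>i<r. ip N (res i) (res i))"
  proof (rule sum_mono)
    fix i assume "i \<in> {..<r}"
    then show "(d - \<delta>)\<^sup>2 * (x i m)\<^sup>2 \<le> ip N (res i) (res i)"
      using far_coord[OF far, of i] member_le_ip[OF mN, of "res i"] by simp
  qed
  also have "\<dots> \<le> \<delta>\<^sup>2" by (rule res_small)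
  finally have "(d - \<delta>)\<^sup>2 * (1225 * (\<Sum>i<r. (x i m)\<^sup>2)) \<le> (d - \<delta>)\<^sup>2 * 1"
    using sq_ineq by (simp add: sum_distrib_left[symmetric])
  then have a: "1225 * (\<Sum>i<r. (x i m)\<^sup>2) \<le> 1" using sq_pos by (simp only: mult_le_cancel_left_pos)
  have "ip N v v = 1" unfolding ipv by (simp add: v_def)
  then have kk: "ip N k k = 1 - (\<Sum>i<r. (x i m)\<^sup>2)"
    using ip_self_decomp[of v] by (simp add: ipv k_def)
  have kk_pos: "0 < ip N k k" and a_le: "(\<Sum>i<r. (x i m)\<^sup>2) \<le> ip N k k" using a kk by auto
  have vk: "ip N v k = ip N k k"
  proof -
    have "ip N v k = v m - (\<Sum>i<r. (x i m)\<^sup>2)"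
      by (simp add: ip_commute[of N v] ipv) (simp add: k_def perp_def ipv power2_eq_square)
    then show ?thesis using kk by (simp add: v_def)
  qed
  have k_eq: "k = (\<lambda>a. v a - (\<Sum>i<r. x i m * x i a))"
    by (simp add: k_def perp_def[abs_def] ipv)
  have "q k k = q v k - (\<Sum>i<r. x i m * q (x i) k)"
    by (subst (1) k_eq) (simp only: q_bilinear)
  also have "q v k = l m * ip N v k"
    unfolding q_def ip_def sum_distrib_left by (intro sum.cong refl) (simp add: v_def)
  also have "(\<Sum>i<r. x i m * q (x i) k) = (\<Sum>i<r. x i m * ip N (res i) k)"
    by (intro sum.cong refl) (simp add: q_frame k)
  finally have "q k k = l m * ip N k k - (\<Sum>i<r. x i m * ip N (res i) k)" by (simp add: vk)
  moreover have "\<bar>\<Sum>i<r. x i m * ip N (res i) k\<bar> \<le> sqrt (ip N k k) * sqrt (ip N k k) * \<delta>"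
    using a_le kk_pos by (intro sum_coeff_res_bound) auto
  ultimately have qk: "q k k \<ge> l m * ip N k k - \<delta> * ip N k k"
    using kk_pos by (simp add: abs_le_iff mult.commute)
  have "rq j * ip N k k - q k k \<le> (rq j - l m + \<delta>) * ip N k k"
    using qk by (simp add: algebra_simps)
  also have "\<dots> \<le> - (17/18 * d) * ip N k k"
    using low gap[OF m order.refl] \<delta>_le kk_pos by (intro mult_right_mono) auto
  finally have neg: "rq j * ip N k k - q k k \<le> - (17/18 * d * ip N k k)" by simp
  define u where "u = (\<lambda>i. if i = j then k else (\<lambda>m. 0))"
  have col: "tangent u" "total u = ip N k k" "main_part u = wt j * (rq j * ip N k k - q k k)"
    unfolding u_def using tangent_column[OF k j] total_column[OF k j] main_part_column[OF k j] by auto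
  have "main_part u \<le> wt j * - (17/18 * d * ip N k k)"
    unfolding col(3) using neg wt_bounds[OF j] by (intro mult_left_mono) auto
  also have "\<dots> \<le> 1 * - (17/18 * d * ip N k k)"
    using wt_bounds[OF j] d_pos kk_pos by (intro mult_right_mono_neg) auto
  finally have mp: "main_part u \<le> - (17/18) * (d * ip N k k)" by simp
  have "hess u \<le> main_part u + 1/12 * (36 * real r * \<delta>) * ip N k k"
    using hess_main_part_bound[of u] unfolding col(2) by (simp add: abs_le_iff mult.commute[of \<delta>])
  then have "hess u \<le> main_part u + 1/12 * (d * ip N k k)" unfolding \<delta>_eq by simp
  moreover have "0 \<le> d * ip N k k" using d_pos kk_pos by simp
  ultimately have "hess u \<le> - (11/100 * d * total u)"
    using mp unfolding col(2) mult.assoc by linarith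
  with col kk_pos show ?thesis by metis
qed

lemma negative_rotation:
  assumes ij: "i < j" and j: "j < r" and wrong: "d - 2 * \<delta> \<le> rq j - rq i"
  shows "\<exists>u. tangent u \<and> 0 < total u \<and> hess u \<le> - (11/100 * d * total u)"
proof -
  have i: "i < r" and ne: "i \<noteq> j" using ij j by auto
  define u where "u = (\<lambda>a m. if a = i then - 1 * x j m else if a = j then 1 * x i m else 0)"
  note rot = tangent_rotation[OF i j ne, folded u_def] total_rotation[OF i j ne, folded u_def]
    main_part_rotation[OF i j ne, folded u_def]
  have w: "1 \<le> wt i - wt j" using wt_diff[OF i j] ij by simp
  have "1 * (d - 2 * \<delta>) \<le> (wt i - wt j) * (rq j - rq i)"
    using w wrong \<delta>_le d_pos by (intro mult_mono) auto
  then have "main_part u \<le> - (d - 2 * \<delta>)" unfolding rot(3) by (simp add: algebra_simps)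
  moreover have "hess u \<le> main_part u + 1/6 * (36 * real r * \<delta>)"
    using hess_main_part_bound[of u] unfolding rot(2) by (simp add: abs_le_iff mult.commute)
  ultimately have "hess u \<le> - (11/100 * d * total u)"
    using \<delta>_le d_pos unfolding \<delta>_eq rot(2) by simp
  with rot show ?thesis by (metis zero_less_numeral)
qed

lemma perp_form_bound:
  assumes k: "\<And>i. i < r \<Longrightarrow> ip N (x i) k = 0"
    and high: "\<And>i. i < r \<Longrightarrow> l r + d - \<delta> \<le> rq i"
  shows "q k k \<le> (l r + 2 * \<delta>) * ip N k k"
proof (rule ccontr)
  assume "\<not> ?thesis"
  then have P: "0 < q k k - (l r + 2 * \<delta>) * ip N k k" by simp
  \<comment> \<open>A nonzero \<open>w\<close> in the span of the frame and \<open>k\<close> that is orthogonal to the top \<open>r\<close> eigenvectors.\<close>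
  obtain s where s: "\<exists>j<Suc r. s j \<noteq> 0"
    and s0: "\<And>m. m < r \<Longrightarrow> (\<Sum>j<Suc r. (if j < r then x j m else k m) * s j) = 0"
    using exists_nontrivial_homogeneous_solution[of r "Suc r" "\<lambda>m j. if j < r then x j m else k m"]
    by blast
  define k' where "k' = (\<lambda>m. s r * k m)"
  define w where "w = (\<lambda>m. (\<Sum>i<r. s i * x i m) + k' m)"
  have k': "ip N (x i) k' = 0" if "i < r" for i
    unfolding k'_def ip_scale_right k[OF that] by simp
  have w: "w m = (\<Sum>i<r. s i * x i m) + k' m" for m by (simp add: w_def)
  have w0: "w m = 0" if "m < r" for m
  proof -
    have "(\<Sum>j<r. (if j < r then x j m else k m) * s j) = (\<Sum>i<r. s i * x i m)"
      by (intro sum.cong) auto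
    then show ?thesis using s0[OF that] by (simp add: w_def k'_def mult.commute)
  qed
  have ww: "ip N w w = (\<Sum>i<r. (s i)\<^sup>2) + (s r)\<^sup>2 * ip N k k"
    using pythagoras[OF k', of s] unfolding w_def[symmetric]
    by (simp add: k'_def ip_scale_left ip_scale_right power2_eq_square)
  have "q w w \<le> l r * ip N w w"
    unfolding q_def ip_def sum_distrib_left
  proof (rule sum_mono)
    fix m assume "m \<in> {..<N}"
    then show "l m * w m * w m \<le> l r * (w m * w m)"
      using w0[of m] tail[of m] by (cases "m < r") (auto simp: mult.assoc intro: mult_right_mono)
  qed
  moreover have "q w w = (\<Sum>i<r. rq i * (s i)\<^sup>2) + (s r)\<^sup>2 * q k k + (\<Sum>i<r. s i * ip N (res i) (\<lambda>m. w m + k' m))"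
    using q_frame_sum_plus[OF k' w] by (simp add: k'_def q_bilinear power2_eq_square)
  moreover have "\<bar>\<Sum>i<r. s i * ip N (res i) (\<lambda>m. w m + k' m)\<bar> \<le> 2 * \<delta> * ip N w w"
    by (rule q_error_bound[OF k' w])
  ultimately have le: "(\<Sum>i<r. rq i * (s i)\<^sup>2) + (s r)\<^sup>2 * q k k \<le> (l r + 2 * \<delta>) * ip N w w"
    by (simp add: abs_le_iff distrib_right)
  have "(l r + d - \<delta>) * (\<Sum>i<r. (s i)\<^sup>2) \<le> (\<Sum>i<r. rq i * (s i)\<^sup>2)"
    unfolding sum_distrib_left by (intro sum_mono mult_right_mono high) auto
  with le have le2: "(d - 3 * \<delta>) * (\<Sum>i<r. (s i)\<^sup>2) + (s r)\<^sup>2 * (q k k - (l r + 2 * \<delta>) * ip N k k) \<le> 0"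
    unfolding ww by (simp add: algebra_simps)
  have dd: "0 < d - 3 * \<delta>" using \<delta>_le d_pos by simp
  have S: "0 \<le> (\<Sum>i<r. (s i)\<^sup>2)" by (simp add: sum_nonneg)
  have n1: "0 \<le> (d - 3 * \<delta>) * (\<Sum>i<r. (s i)\<^sup>2)" using dd S by simp
  have n2: "0 \<le> (s r)\<^sup>2 * (q k k - (l r + 2 * \<delta>) * ip N k k)" using P by simp
  from le2 n1 n2 have "(d - 3 * \<delta>) * (\<Sum>i<r. (s i)\<^sup>2) = 0" and "(s r)\<^sup>2 * (q k k - (l r + 2 * \<delta>) * ip N k k) = 0"
    by linarith+
  then have "(\<Sum>i<r. (s i)\<^sup>2) = 0" and "s r = 0" using dd P by auto
  moreover from this(1) have "\<forall>i<r. s i = 0" by (subst (asm) sum_nonneg_eq_0_iff) auto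
  ultimately show False using s by (auto simp: less_Suc_eq)
qed

lemma positive_hess:
  assumes u: "tangent u"
    and ord: "\<And>i j. i < j \<Longrightarrow> j < r \<Longrightarrow> d - 2 * \<delta> \<le> rq i - rq j"
    and high: "\<And>i. i < r \<Longrightarrow> l r + d - \<delta> \<le> rq i"
  shows "11/100 * d * total u \<le> hess u"
proof -
  define s where "s i j = ip N (x i) (u j)" for i j
  have skew: "s i j = - s j i" if "i < r" "j < r" for i j
    using u that unfolding tangent_def s_def ip_commute[of N "x j"] by (simp add: eq_neg_iff_add_eq_0)
  let ?g = "d - 3 * \<delta>"
  have g: "0 \<le> ?g" using \<delta>_le d_pos by simp
  let ?F = "\<Sum>j<r. wt j * (\<Sum>i<r. (rq j - rq i) * (s i j)\<^sup>2)"
  let ?S = "\<Sum>j<r. \<Sum>i<r. (s i j)\<^sup>2"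
  let ?K = "\<Sum>j<r. ip N (perp (u j)) (perp (u j))"
  have F1: "?F = (\<Sum>j<r. \<Sum>i<r. wt j * (rq j - rq i) * (s i j)\<^sup>2)"
    by (simp add: sum_distrib_left mult.assoc)
  also have "\<dots> = (\<Sum>j<r. \<Sum>i<r. wt i * (rq i - rq j) * (s j i)\<^sup>2)"
    by (rule sum.swap)
  also have "\<dots> = (\<Sum>j<r. \<Sum>i<r. - wt i * (rq j - rq i) * (s i j)\<^sup>2)"
  proof (intro sum.cong refl)
    fix i j assume "i \<in> {..<r}" "j \<in> {..<r}"
    then have "(s j i)\<^sup>2 = (s i j)\<^sup>2" using skew[of j i] by simp
    then show "wt i * (rq i - rq j) * (s j i)\<^sup>2 = - wt i * (rq j - rq i) * (s i j)\<^sup>2"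
      by (simp add: algebra_simps)
  qed
  finally have "2 * ?F = (\<Sum>j<r. \<Sum>i<r. (wt j - wt i) * (rq j - rq i) * (s i j)\<^sup>2)"
    unfolding mult_2 by (subst (1) F1) (simp add: sum.distrib[symmetric] sum_subtractf[symmetric] algebra_simps)
  moreover have "?g * ?S \<le> (\<Sum>j<r. \<Sum>i<r. (wt j - wt i) * (rq j - rq i) * (s i j)\<^sup>2)"
    unfolding sum_distrib_left
  proof (intro sum_mono)
    fix i j assume "i \<in> {..<r}" "j \<in> {..<r}"
    then have i: "i < r" and j: "j < r" by auto
    show "?g * (s i j)\<^sup>2 \<le> (wt j - wt i) * (rq j - rq i) * (s i j)\<^sup>2"
    proof (cases i j rule: linorder_cases)
      case equal
      then have "s i j = 0" using skew[OF i j] by simp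
      then show ?thesis by simp
    next
      case less
      have "1 * ?g \<le> (wt i - wt j) * (rq i - rq j)"
        using less wt_diff[OF i j] ord[OF less j] \<delta>_nonneg g by (intro mult_mono) auto
      then show ?thesis by (intro mult_right_mono) (auto simp: algebra_simps)
    next
      case greater
      have "1 * ?g \<le> (wt j - wt i) * (rq j - rq i)"
        using greater wt_diff[OF j i] ord[OF greater i] \<delta>_nonneg g by (intro mult_mono) auto
      then show ?thesis by (intro mult_right_mono) auto
    qed
  qed
  ultimately have F: "?g * ?S \<le> 2 * ?F" by simp
  have "?g * ?K \<le> (\<Sum>j<r. wt j * (rq j * ip N (perp (u j)) (perp (u j)) - q (perp (u j)) (perp (u j))))"
    unfolding sum_distrib_left
  proof (rule sum_mono)
    fix j assume "j \<in> {..<r}"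
    then have j: "j < r" by simp
    let ?k = "perp (u j)"
    have "?g * ip N ?k ?k \<le> (rq j - (l r + 2 * \<delta>)) * ip N ?k ?k"
      using high[OF j] ip_nonneg[of N ?k] by (intro mult_right_mono) auto
    also have "\<dots> \<le> rq j * ip N ?k ?k - q ?k ?k"
      using perp_form_bound[OF ip_frame_perp high, of "u j"] by (simp add: left_diff_distrib)
    finally have "1 * (?g * ip N ?k ?k) \<le> wt j * (rq j * ip N ?k ?k - q ?k ?k)"
      using wt_bounds[OF j] g ip_nonneg[of N ?k] by (intro mult_mono) auto
    then show "?g * ip N ?k ?k \<le> wt j * (rq j * ip N ?k ?k - q ?k ?k)" by simp
  qed
  then have "?F + ?g * ?K \<le> main_part u" by (simp add: main_part_def s_def)
  moreover have "0 \<le> ?g * ?K" using g by (simp add: sum_nonneg ip_nonneg)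
  moreover have "total u = ?S + ?K"
    unfolding total_def s_def by (subst ip_self_decomp) (simp add: sum.distrib)
  ultimately have "1/2 * (?g * total u) \<le> main_part u" using F by (simp add: distrib_left)
  moreover have "main_part u - 1/12 * (36 * real r * \<delta>) * total u \<le> hess u"
    using hess_main_part_bound[of u] by (simp add: abs_le_iff mult.commute[of \<delta>])
  then have "main_part u - 1/12 * d * total u \<le> hess u" unfolding \<delta>_eq .
  moreover have "11/12 * d * total u \<le> ?g * total u"
    using \<delta>_le total_nonneg by (intro mult_right_mono) auto
  moreover have "0 \<le> d * total u" using d_pos total_nonneg[of u] by simp
  ultimately show ?thesis unfolding mult.assoc by linarith
qed

theorem hess_dichotomy:
  "(\<forall>u. tangent u \<longrightarrow> 11/100 * d * total u \<le> hess u)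
    \<or> (\<exists>u. tangent u \<and> 0 < total u \<and> hess u \<le> - (11/100 * d * total u))"
proof -
  have "\<forall>j. \<exists>m. j < r \<longrightarrow> m < N \<and> \<bar>rq j - l m\<bar> \<le> \<delta>" using nearby_eigenvalue by blast
  then obtain \<sigma> where \<sigma>: "\<And>j. j < r \<Longrightarrow> \<sigma> j < N" "\<And>j. j < r \<Longrightarrow> \<bar>rq j - l (\<sigma> j)\<bar> \<le> \<delta>"
    by metis
  show ?thesis
  proof (cases "\<exists>j<r. r \<le> \<sigma> j")
    case True
    then obtain j where j: "j < r" "r \<le> \<sigma> j" by blast
    have "\<not> {..<r} \<subseteq> \<sigma> ` {..<r}"
    proof
      assume sub: "{..<r} \<subseteq> \<sigma> ` {..<r}"
      have "card (\<sigma> ` {..<r}) \<le> card {..<r}" by (rule card_image_le) simp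
      with sub have "{..<r} = \<sigma> ` {..<r}" by (intro card_seteq) auto
      with j show False by (metis imageI lessThan_iff not_less)
    qed
    then obtain m where m: "m < r" "m \<notin> \<sigma> ` {..<r}" by auto
    have "d - \<delta> \<le> \<bar>rq i - l m\<bar>" if i: "i < r" for i
    proof -
      have "m \<noteq> \<sigma> i" using m i by auto
      then show ?thesis using gap_abs[OF m(1) \<sigma>(1)[OF i]] \<sigma>(2)[OF i] by auto
    qed
    moreover have "rq j \<le> l r + \<delta>" using \<sigma>[OF j(1)] tail[OF j(2)] by auto
    ultimately show ?thesis using negative_perp_direction[OF j(1) m(1)] by blast
  next
    case False
    then have \<sigma>r: "\<sigma> j < r" if "j < r" for j using that by auto
    have sep: "d - 2 * \<delta> \<le> \<bar>rq i - rq j\<bar>" if "i < j" "j < r" for i j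
    proof -
      have i: "i < r" using that by simp
      have "\<sigma> i \<noteq> \<sigma> j"
        using nearby_inj[of i j "\<sigma> i"] \<sigma>(2)[OF i] \<sigma>(2)[OF that(2)] \<sigma>r[OF i] that by auto
      then show ?thesis
        using gap_abs[OF \<sigma>r[OF i] \<sigma>(1)[OF that(2)]] \<sigma>(2)[OF i] \<sigma>(2)[OF that(2)] by auto
    qed
    show ?thesis
    proof (cases "\<exists>i j. i < j \<and> j < r \<and> rq i < rq j")
      case True
      then obtain i j where ij: "i < j" "j < r" "rq i < rq j" by blast
      then show ?thesis using negative_rotation[of i j] sep[of i j] by auto
    next
      case False
      have ord: "d - 2 * \<delta> \<le> rq i - rq j" if "i < j" "j < r" for i j
        using sep[OF that] False that by force
      have high: "l r + d - \<delta> \<le> rq i" if "i < r" for i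
        using gap[OF \<sigma>r[OF that] order.refl] \<sigma>(2)[OF that] by auto
      show ?thesis using positive_hess[OF _ ord high] by blast
    qed
  qed
qed

end

context orthonormal_frame
begin

lemma hess_bounded_below: "\<exists>C. \<forall>u. total u = 1 \<longrightarrow> C \<le> hess u"
proof (intro exI allI impI)
  fix u assume u: "total u = 1"
  have u1: "ip N (u j) (u j) \<le> 1" if "j < r" for j
    using member_le_sum[of j "{..<r}" "\<lambda>j. ip N (u j) (u j)"] that u
    by (simp add: total_def ip_nonneg)
  have "- (\<Sum>j<r. wt j * ((\<Sum>i<r. \<bar>A i j\<bar>) + (\<Sum>m<N. \<bar>l m\<bar>)))
     = (\<Sum>j<r. wt j * ((\<Sum>i<r. - \<bar>A i j\<bar>) - (\<Sum>m<N. \<bar>l m\<bar>)))"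
    unfolding sum_negf[of _ "{..<r}", symmetric]
    by (intro sum.cong refl) (simp add: sum_negf algebra_simps)
  also have "\<dots> \<le> hess u"
    unfolding hess_def
  proof (rule sum_mono)
    fix j assume "j \<in> {..<r}"
    then have j: "j < r" by simp
    have "(\<Sum>i<r. - \<bar>A i j\<bar>) \<le> (\<Sum>i<r. A i j * ip N (u i) (u j))"
    proof (rule sum_mono)
      fix i assume "i \<in> {..<r}"
      then have i: "i < r" by simp
      have "(ip N (u i) (u j))\<^sup>2 \<le> 1 * 1"
        by (rule order_trans[OF ip_Cauchy_Schwarz mult_mono]) (use u1 i j ip_nonneg in auto)
      then have "\<bar>ip N (u i) (u j)\<bar> \<le> 1" by (simp add: abs_square_le_1)
      then have "\<bar>A i j * ip N (u i) (u j)\<bar> \<le> \<bar>A i j\<bar> * 1"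
        unfolding abs_mult by (intro mult_left_mono) auto
      then show "- \<bar>A i j\<bar> \<le> A i j * ip N (u i) (u j)" by linarith
    qed
    moreover have "q (u j) (u j) \<le> (\<Sum>m<N. \<bar>l m\<bar>)"
      unfolding q_def ip_def
    proof (rule sum_mono)
      fix m assume "m \<in> {..<N}"
      then have "(u j m)\<^sup>2 \<le> 1" using member_le_ip[of m N "u j"] u1[OF j] by simp
      then have "\<bar>l m\<bar> * (u j m)\<^sup>2 \<le> \<bar>l m\<bar> * 1" by (intro mult_left_mono) auto
      moreover have "l m * (u j m)\<^sup>2 \<le> \<bar>l m\<bar> * (u j m)\<^sup>2" by (intro mult_right_mono) auto
      ultimately show "l m * u j m * u j m \<le> \<bar>l m\<bar>" by (simp add: power2_eq_square)
    qed
    ultimately show "wt j * ((\<Sum>i<r. - \<bar>A i j\<bar>) - (\<Sum>m<N. \<bar>l m\<bar>))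
        \<le> wt j * ((\<Sum>i<r. A i j * ip N (u i) (u j)) - q (u j) (u j))"
      using wt_bounds[OF j] by (intro mult_left_mono) auto
  qed
  finally show "- (\<Sum>j<r. wt j * ((\<Sum>i<r. \<bar>A i j\<bar>) + (\<Sum>m<N. \<bar>l m\<bar>))) \<le> hess u" .
qed

lemma exists_tangent_nonzero:
  assumes "1 \<le> r" "r < N"
  shows "\<exists>u. tangent u \<and> 0 < total u"
proof -
  obtain k where k: "\<exists>m<N. k m \<noteq> 0" "\<And>i. i < r \<Longrightarrow> (\<Sum>m<N. x i m * k m) = 0"
    using exists_nontrivial_homogeneous_solution[OF assms(2), of x] by blast
  have orth_k: "ip N (x i) k = 0" if "i < r" for i using k(2)[OF that] by (simp add: ip_def)
  have "0 < ip N k k" using k(1) ip_eq_0_iff[of N k] ip_nonneg[of N k] by (auto simp: less_le)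
  then show ?thesis
    using tangent_column[OF orth_k, of 0] total_column[OF orth_k, of 0] assms(1) by force
qed

lemma normalize_tangent:
  assumes "tangent u" "0 < total u"
  shows "\<exists>w. tangent w \<and> total w = 1 \<and> hess w = hess u / total u"
  using assms
  by (intro exI[of _ "\<lambda>j m. 1 / sqrt (total u) * u j m"])
    (auto simp only: tangent_scale total_scale hess_scale power_divide real_sqrt_pow2 less_imp_le, auto)

end

section \<open>Transfer to matrices\<close>

lemma mult_mat_entry:
  assumes "P \<in> carrier_mat n k" "Q \<in> carrier_mat k n'" "i < n" "j < n'"
  shows "(P * Q) $$ (i, j) = (\<Sum>a<k. P $$ (i, a) * Q $$ (a, j))"
  using assms by (simp add: scalar_prod_def lessThan_atLeast0)

text \<open>In this locale \<open>coord Z j\<close> is the \<open>j\<close>-th column of \<open>Z\<close> in the eigenbasis \<open>V\<close> of \<open>M\<close>.\<close>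

locale diagonalized_stiefel =
  fixes M V X :: "real mat" and N r :: nat and l :: "nat \<Rightarrow> real"
  assumes V: "V \<in> carrier_mat N N" and VTV: "V\<^sup>T * V = 1\<^sub>m N" and VVT: "V * V\<^sup>T = 1\<^sub>m N"
    and M_eq: "M = V * mat_diag N l * V\<^sup>T"
    and X: "X \<in> carrier_mat N r" and XTX: "X\<^sup>T * X = 1\<^sub>m r"
begin

definition coord :: "real mat \<Rightarrow> nat \<Rightarrow> nat \<Rightarrow> real" where
  "coord Z j m = (V\<^sup>T * Z) $$ (m, j)"

lemma M: "M \<in> carrier_mat N N"
  unfolding M_eq using V by (intro mult_carrier_mat[of _ N N]) auto

lemma gram_entry:
  assumes Z: "Z \<in> carrier_mat N r" and W: "W \<in> carrier_mat N r" and i: "i < r" and j: "j < r"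
  shows "(Z\<^sup>T * W) $$ (i, j) = ip N (coord Z i) (coord W j)"
proof -
  have "(V\<^sup>T * Z)\<^sup>T * (V\<^sup>T * W) = Z\<^sup>T * (V * V\<^sup>T * W)"
    using V Z W by (simp add: transpose_mult[of _ N N _ r] assoc_mult_mat[of _ N N _ N _ r] assoc_mult_mat[of _ r N _ N _ r])
  then have "Z\<^sup>T * W = (V\<^sup>T * Z)\<^sup>T * (V\<^sup>T * W)" using W by (simp add: VVT)
  then show ?thesis
    using V Z W i j by (simp add: scalar_prod_def ip_def coord_def lessThan_atLeast0)
qed

lemma form_entry:
  assumes Z: "Z \<in> carrier_mat N r" and W: "W \<in> carrier_mat N r" and i: "i < r" and j: "j < r"
  shows "(Z\<^sup>T * M * W) $$ (i, j) = ip N (\<lambda>m. l m * coord Z i m) (coord W j)"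
proof -
  let ?L = "mat_diag N l"
  have L: "?L \<in> carrier_mat N N" by simp
  have "Z\<^sup>T * M * W = (V\<^sup>T * Z)\<^sup>T * (?L * (V\<^sup>T * W))"
    unfolding M_eq using V Z W L
    by (simp add: transpose_mult[of _ N N _ r] assoc_mult_mat[of _ N N _ N _ r]
        assoc_mult_mat[of _ r N _ N _ r] assoc_mult_mat[of _ r N _ N _ N] assoc_mult_mat[of _ N N _ N _ N]
        mult_carrier_mat[of _ N N])
  also have "?L * (V\<^sup>T * W) = mat N r (\<lambda>(m, j). l m * coord W j m)"
    unfolding coord_def by (rule mat_diag_mult_left) (use V W in simp)
  finally show ?thesis
    using V Z W i j by (simp add: scalar_prod_def ip_def coord_def lessThan_atLeast0 mult_ac)
qed

sublocale orthonormal_frame N r l "coord X"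
  by unfold_locales (use gram_entry[OF X X] XTX in auto)

lemma tangent_iff:
  assumes U: "U \<in> carrier_mat N r"
  shows "U \<in> tangent_stiefel N r X \<longleftrightarrow> tangent (coord U)"
proof -
  have "X\<^sup>T * U + U\<^sup>T * X = 0\<^sub>m r r \<longleftrightarrow>
      (\<forall>i<r. \<forall>j<r. (X\<^sup>T * U) $$ (i,j) + (U\<^sup>T * X) $$ (i,j) = 0)"
    using U X by (auto simp: mat_eq_iff simp del: index_mult_mat(1))
  then show ?thesis
    unfolding tangent_stiefel_def tangent_def using U X by (auto simp: gram_entry simp del: index_mult_mat(1))
qed

lemma frob_norm_eq:
  assumes U: "U \<in> carrier_mat N r"
  shows "frob_norm U = sqrt (total (coord U))"
proof -
  have "frob_inner U U = (\<Sum>j<r. (U\<^sup>T * U) $$ (j, j))"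
    using U unfolding frob_inner_def
    by (subst sum.swap) (simp add: scalar_prod_def lessThan_atLeast0)
  also have "\<dots> = total (coord U)"
    unfolding total_def by (intro sum.cong refl gram_entry) (use U in auto)
  finally show ?thesis by (simp add: frob_norm_def)
qed

lemma Nmat_mult_right:
  assumes "B \<in> carrier_mat n r" "i < n" "j < r"
  shows "(B * Nmat r) $$ (i, j) = B $$ (i, j) * wt j"
proof -
  have "Nmat r = mat_diag r wt"
    by (rule eq_matI) (auto simp: Nmat_def mat_diag_def wt_def)
  then show ?thesis using mat_diag_mult_right[OF assms(1), of wt] assms by simp
qed

lemma Nmat_mult_left:
  assumes "B \<in> carrier_mat r n" "i < r" "j < n"
  shows "(Nmat r * B) $$ (i, j) = wt i * B $$ (i, j)"
proof -
  have "Nmat r = mat_diag r wt"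
    by (rule eq_matI) (auto simp: Nmat_def mat_diag_def wt_def)
  then show ?thesis using mat_diag_mult_left[OF assms(1), of wt] assms by simp
qed

lemma Nmat_carrier: "Nmat r \<in> carrier_mat r r"
  by (simp add: Nmat_def)

lemma hess_g_eq:
  assumes U: "U \<in> carrier_mat N r"
  shows "hess_g M r X U = hess (coord U)"
proof -
  have "frob_inner (X\<^sup>T * M * X) (U\<^sup>T * U * Nmat r)
      = (\<Sum>i<r. \<Sum>j<r. A i j * (ip N (coord U i) (coord U j) * wt j))"
  proof -
    have UU: "U\<^sup>T * U \<in> carrier_mat r r" using U by simp
    have "dim_row (X\<^sup>T * M * X) = r" "dim_col (X\<^sup>T * M * X) = r" using X by auto
    then show ?thesis
      unfolding frob_inner_def A_def q_def
      by (simp only:, intro sum.cong refl)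
        (simp only: lessThan_iff form_entry[OF X X] gram_entry[OF U U] Nmat_mult_right[OF UU])
  qed
  also have "\<dots> = (\<Sum>j<r. wt j * (\<Sum>i<r. A i j * ip N (coord U i) (coord U j)))"
    by (subst sum.swap) (simp add: sum_distrib_left mult_ac)
  finally have 1: "frob_inner (X\<^sup>T * M * X) (U\<^sup>T * U * Nmat r)
    = (\<Sum>j<r. wt j * (\<Sum>i<r. A i j * ip N (coord U i) (coord U j)))" .
  have UN: "U * Nmat r \<in> carrier_mat N r" using U Nmat_carrier by simp
  have entry: "(U * Nmat r * U\<^sup>T) $$ (a, b) = (\<Sum>j<r. wt j * (U $$ (a, j) * U $$ (b, j)))"
    if "a < N" "b < N" for a b
  proof -
    have "(U * Nmat r * U\<^sup>T) $$ (a, b) = (\<Sum>j<r. (U * Nmat r) $$ (a, j) * U $$ (b, j))"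
      using U UN that
      by (subst index_mult_mat(1)) (auto simp: scalar_prod_def lessThan_atLeast0 index_row(1) simp del: index_mult_mat(1))
    then show ?thesis using U that by (simp add: Nmat_mult_right[of _ N] mult_ac del: index_mult_mat(1))
  qed
  have diag: "(U\<^sup>T * M * U) $$ (j, j) = (\<Sum>a<N. \<Sum>b<N. M $$ (a, b) * (U $$ (a, j) * U $$ (b, j)))"
    if "j < r" for j
  proof -
    have "(U\<^sup>T * M * U) $$ (j, j) = (\<Sum>a<N. U $$ (a, j) * (\<Sum>b<N. M $$ (a, b) * U $$ (b, j)))"
      using U M that by (simp add: scalar_prod_def lessThan_atLeast0)
    then show ?thesis
      by (simp add: sum_distrib_left mult_ac)
  qed
  have "frob_inner M (U * Nmat r * U\<^sup>T) = (\<Sum>a<N. \<Sum>b<N. \<Sum>j<r. wt j * (M $$ (a, b) * (U $$ (a, j) * U $$ (b, j))))"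
    unfolding frob_inner_def using M U entry
    by (simp add: sum_distrib_left mult_ac del: index_mult_mat(1))
  also have "\<dots> = (\<Sum>a<N. \<Sum>j<r. \<Sum>b<N. wt j * (M $$ (a, b) * (U $$ (a, j) * U $$ (b, j))))"
    by (intro sum.cong refl sum.swap)
  also have "\<dots> = (\<Sum>j<r. \<Sum>a<N. \<Sum>b<N. wt j * (M $$ (a, b) * (U $$ (a, j) * U $$ (b, j))))"
    by (rule sum.swap)
  also have "\<dots> = (\<Sum>j<r. wt j * q (coord U j) (coord U j))"
  proof (intro sum.cong refl)
    fix j assume "j \<in> {..<r}"
    then have j: "j < r" by simp
    show "(\<Sum>a<N. \<Sum>b<N. wt j * (M $$ (a, b) * (U $$ (a, j) * U $$ (b, j)))) = wt j * q (coord U j) (coord U j)"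
      using form_entry[OF U U j j] unfolding diag[OF j] q_def by (simp add: sum_distrib_left[symmetric])
  qed
  finally show ?thesis
    unfolding hess_g_def 1 hess_def by (simp add: right_diff_distrib sum_subtractf)
qed

lemma grad_g_carrier: "grad_g M r X \<in> carrier_mat N r"
  using X M Nmat_carrier by (auto simp: grad_g_def commutator_def)

lemma coord_grad_g:
  assumes m: "m < N" and j: "j < r"
  shows "coord (grad_g M r X) j m = grad j m"
proof -
  let ?L = "mat_diag N l"
  let ?Y = "V\<^sup>T * X"
  let ?A = "X\<^sup>T * M * X"
  let ?C = "commutator ?A (Nmat r)"
  have L: "?L \<in> carrier_mat N N" by simp
  have VT: "V\<^sup>T \<in> carrier_mat N N" using V by simp
  have Y: "?Y \<in> carrier_mat N r" using V X by simp
  have Ac: "?A \<in> carrier_mat r r" using X M by simp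
  have C: "?C \<in> carrier_mat r r"
    unfolding commutator_def by (intro minus_carrier_mat mult_carrier_mat[OF Nmat_carrier Ac])
  have XT: "X\<^sup>T \<in> carrier_mat r N" using X by simp
  have MX: "M * X \<in> carrier_mat N r" using M X by simp
  have "V\<^sup>T * M = (V\<^sup>T * V) * ?L * V\<^sup>T"
    unfolding M_eq using V by (simp add: assoc_mult_mat[of _ N N _ N _ N])
  then have VTM: "V\<^sup>T * M = ?L * V\<^sup>T" using VT by (simp add: VTV left_mult_one_mat[OF L])
  have eq1: "V\<^sup>T * ((X * X\<^sup>T - 1\<^sub>m N) * M * X * Nmat r) = (?Y * ?A - ?L * ?Y) * Nmat r"
  proof -
    have "V\<^sup>T * ((X * X\<^sup>T - 1\<^sub>m N) * (M * X)) = V\<^sup>T * (X * (X\<^sup>T * (M * X)) - M * X)"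
      using X XT MX by (simp add: minus_mult_distrib_mat[of _ N N] assoc_mult_mat[of _ N r _ N _ r]
          left_mult_one_mat[OF MX] del: assoc_mult_mat)
    also have "\<dots> = V\<^sup>T * (X * (X\<^sup>T * (M * X))) - V\<^sup>T * (M * X)"
      by (rule mult_minus_distrib_mat[OF VT]) (use X XT MX in auto)
    also have "V\<^sup>T * (X * (X\<^sup>T * (M * X))) = ?Y * ?A"
      using VT X XT M by (simp add: assoc_mult_mat[of _ N N _ r _ r] assoc_mult_mat[of _ r N _ N _ r])
    also have "V\<^sup>T * (M * X) = ?L * ?Y"
      using VTM VT M X L assoc_mult_mat[OF VT M X] assoc_mult_mat[OF L VT X] by simp
    finally have *: "V\<^sup>T * ((X * X\<^sup>T - 1\<^sub>m N) * (M * X)) = ?Y * ?A - ?L * ?Y" .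
    have P: "X * X\<^sup>T - 1\<^sub>m N \<in> carrier_mat N N" by (intro minus_carrier_mat one_carrier_mat)
    have "V\<^sup>T * ((X * X\<^sup>T - 1\<^sub>m N) * M * X * Nmat r) = V\<^sup>T * ((X * X\<^sup>T - 1\<^sub>m N) * (M * X)) * Nmat r"
      using VT P M X MX Nmat_carrier assoc_mult_mat[OF P M X]
      by (simp add: assoc_mult_mat[of _ N N _ r _ r])
    then show ?thesis unfolding * .
  qed
  have eq2: "V\<^sup>T * ((1/2) \<cdot>\<^sub>m (X * ?C)) = (1/2) \<cdot>\<^sub>m (?Y * ?C)"
    using mult_smult_distrib[OF VT, of "X * ?C" r "1/2"] X C assoc_mult_mat[OF VT X C] by simp
  have "V\<^sup>T * grad_g M r X = (?Y * ?A - ?L * ?Y) * Nmat r - (1/2) \<cdot>\<^sub>m (?Y * ?C)"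
    unfolding grad_g_def eq1[symmetric] eq2[symmetric] using X
    by (simp, intro mult_minus_distrib_mat[OF VT]) (use X M C Nmat_carrier in auto)
  then have "coord (grad_g M r X) j m
      = ((?Y * ?A - ?L * ?Y) * Nmat r) $$ (m, j) - 1/2 * (?Y * ?C) $$ (m, j)"
  proof -
    have idx: "(P - (1/2) \<cdot>\<^sub>m Q) $$ (m, j) = P $$ (m, j) - 1/2 * Q $$ (m, j)"
      if "P \<in> carrier_mat N r" "Q \<in> carrier_mat N r" for P Q :: "real mat"
      using that m j by simp
    have c: "(?Y * ?A - ?L * ?Y) * Nmat r \<in> carrier_mat N r" "?Y * ?C \<in> carrier_mat N r"
      by (intro mult_carrier_mat[OF _ Nmat_carrier] minus_carrier_mat mult_carrier_mat[OF L Y]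
          mult_carrier_mat[OF Y C])+
    show ?thesis
      unfolding coord_def \<open>V\<^sup>T * grad_g M r X = _\<close> by (rule idx[OF c])
  qed
  also have "((?Y * ?A - ?L * ?Y) * Nmat r) $$ (m, j) = ((?Y * ?A) $$ (m, j) - (?L * ?Y) $$ (m, j)) * wt j"
  proof -
    have idx: "(P - Q) $$ (m, j) = P $$ (m, j) - Q $$ (m, j)"
      if "Q \<in> carrier_mat N r" for P Q :: "real mat"
      using that m j by simp
    have LY: "?L * ?Y \<in> carrier_mat N r" by (rule mult_carrier_mat[OF L Y])
    show ?thesis
      unfolding Nmat_mult_right[OF minus_carrier_mat[OF LY] m j] idx[OF LY] ..
  qed
  also have "(?L * ?Y) $$ (m, j) = l m * coord X j m"
    using mat_diag_mult_left[OF Y, of l] m j by (simp add: coord_def)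
  also have "(?Y * ?A) $$ (m, j) = (\<Sum>i<r. coord X i m * ?A $$ (i, j))"
    unfolding coord_def by (rule mult_mat_entry[OF Y Ac m j])
  also have "\<dots> = (\<Sum>i<r. A i j * coord X i m)"
    by (intro sum.cong refl) (use j in \<open>simp add: A_def q_def form_entry[OF X X] mult.commute del: index_mult_mat(1)\<close>)
  also have "(?Y * ?C) $$ (m, j) = (\<Sum>i<r. coord X i m * ?C $$ (i, j))"
    unfolding coord_def by (rule mult_mat_entry[OF Y C m j])
  also have "\<dots> = (\<Sum>i<r. A i j * (wt j - wt i) * coord X i m)"
  proof (intro sum.cong refl)
    fix i assume "i \<in> {..<r}"
    then have i: "i < r" by simp
    have "?C $$ (i, j) = (?A * Nmat r) $$ (i, j) - (Nmat r * ?A) $$ (i, j)"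
      unfolding commutator_def
      by (rule index_minus_mat(1)) (use i j X Nmat_carrier in auto)
    also have "\<dots> = ?A $$ (i, j) * wt j - wt i * ?A $$ (i, j)"
      by (simp only: Nmat_mult_right[OF Ac i j] Nmat_mult_left[OF Ac i j])
    finally have "?C $$ (i, j) = A i j * (wt j - wt i)"
      using form_entry[OF X X i j] by (simp add: A_def q_def algebra_simps)
    then show "coord X i m * ?C $$ (i, j) = A i j * (wt j - wt i) * coord X i m" by simp
  qed
  finally show ?thesis by (simp add: grad_def mult.commute)
qed

lemma frob_norm_grad_g: "(frob_norm (grad_g M r X))\<^sup>2 = (\<Sum>j<r. ip N (grad j) (grad j))"
proof -
  have "total (coord (grad_g M r X)) = (\<Sum>j<r. ip N (grad j) (grad j))"
    unfolding total_def ip_def by (intro sum.cong refl) (simp add: coord_grad_g)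
  then show ?thesis
    unfolding frob_norm_eq[OF grad_g_carrier] using total_nonneg[of "coord (grad_g M r X)"] by simp
qed

lemma exists_mat_with_coord:
  "\<exists>U\<in>carrier_mat N r. tangent (coord U) = tangent u \<and> total (coord U) = total u \<and> hess (coord U) = hess u"
proof -
  define W where "W = mat N r (\<lambda>(m, j). u j m)"
  have W: "W \<in> carrier_mat N r" by (simp add: W_def)
  have VT: "V\<^sup>T \<in> carrier_mat N N" using V by simp
  have "V\<^sup>T * (V * W) = W"
    using assoc_mult_mat[OF VT V W] W by (simp add: VTV)
  then have c: "coord (V * W) j m = u j m" if "m < N" "j < r" for j m
    using that by (simp add: coord_def W_def)
  have ipl: "ip N (coord (V * W) j) g = ip N (u j) g" if "j < r" for j g
    unfolding ip_def by (intro sum.cong refl) (use that c in auto)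
  have ipr: "ip N g (coord (V * W) j) = ip N g (u j)" if "j < r" for j g
    unfolding ip_def by (intro sum.cong refl) (use that c in auto)
  have qq: "q (coord (V * W) j) (coord (V * W) j) = q (u j) (u j)" if "j < r" for j
    unfolding q_def ip_def by (intro sum.cong refl) (use that c in auto)
  have "V * W \<in> carrier_mat N r" using V W by simp
  then show ?thesis
    by (intro bexI[of _ "V * W"])
      (auto simp: tangent_def total_def hess_def ipl ipr qq)
qed

lemma hess_values_eq:
  "{hess_g M r X U | U. U \<in> tangent_stiefel N r X \<and> frob_norm U = 1}
    = {hess u | u. tangent u \<and> total u = 1}"
proof (intro equalityI subsetI)
  fix y assume "y \<in> {hess_g M r X U | U. U \<in> tangent_stiefel N r X \<and> frob_norm U = 1}"
  then obtain U where U: "y = hess_g M r X U" "U \<in> tangent_stiefel N r X" "frob_norm U = 1" by auto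
  have Uc: "U \<in> carrier_mat N r" using U(2) by (simp add: tangent_stiefel_def)
  show "y \<in> {hess u | u. tangent u \<and> total u = 1}"
    using U by (auto simp: hess_g_eq[OF Uc] tangent_iff[OF Uc] frob_norm_eq[OF Uc])
next
  fix y assume "y \<in> {hess u | u. tangent u \<and> total u = 1}"
  then obtain u where u: "y = hess u" "tangent u" "total u = 1" by auto
  obtain U where Uc: "U \<in> carrier_mat N r"
    and U: "tangent (coord U) = tangent u" "total (coord U) = total u" "hess (coord U) = hess u"
    using exists_mat_with_coord by blast
  then show "y \<in> {hess_g M r X U | U. U \<in> tangent_stiefel N r X \<and> frob_norm U = 1}"
    using u by (intro CollectI exI[of _ U])
      (simp add: hess_g_eq[OF Uc] tangent_iff[OF Uc] frob_norm_eq[OF Uc])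
qed

end

theorem theorem3:
  fixes M X :: "real mat" and N r :: nat and lam :: "nat \<Rightarrow> real"
  assumes M_carrier: "M \<in> carrier_mat N N"
    and M_sym: "M\<^sup>T = M"
    and r_pos: "1 \<le> r" and r_lt: "r < N"
    and eigs: "char_poly M = (\<Prod>i\<in>{1..N}. [:- lam i, 1:])"
    and strict: "\<And>s. 1 \<le> s \<Longrightarrow> s \<le> r \<Longrightarrow> lam s > lam (Suc s)"
    and weak: "\<And>s. r + 1 \<le> s \<Longrightarrow> s < N \<Longrightarrow> lam s \<ge> lam (Suc s)"
    and X: "X \<in> stiefel N r"
    and small_grad: "frob_norm (grad_g M r X)
        \<le> (1/72) * (1 / real r) * Min {lam s - lam j | s j. 1 \<le> s \<and> s < j \<and> j \<le> r + 1}"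
  shows "\<bar>lambda_min_hess M N r X\<bar>
        \<ge> (11/100) * Min {lam s - lam j | s j. 1 \<le> s \<and> s < j \<and> j \<le> r + 1}"
proof -
  define D where "D = {lam s - lam j | s j. 1 \<le> s \<and> s < j \<and> j \<le> r + 1}"
  define d where "d = Min D"
  define l where "l m = lam (Suc m)" for m
  define \<delta> where "\<delta> = d / (36 * real r)"
  have "D \<subseteq> (\<lambda>(s, j). lam s - lam j) ` ({..r + 1} \<times> {..r + 1})"
    unfolding D_def by force
  then have fin: "finite D" by (rule finite_subset) simp
  have ne: "lam 1 - lam 2 \<in> D" unfolding D_def using r_pos by force
  have dec: "lam j < lam s" if "1 \<le> s" "s < j" "j \<le> r + 1" for s j
    using that(2,3)
  proof (induction j rule: less_induct)
    case (less j)
    then obtain i where i: "j = Suc i" "s \<le> i" by (cases j) auto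
    then show ?case
      using strict[of i] less that(1) by (cases "s = i") force+
  qed
  have d_pos: "0 < d"
    unfolding d_def using fin ne dec by (subst Min_gr_iff) (auto simp: D_def)
  have gap: "d \<le> l s - l t" if "s < t" "t \<le> r" for s t
    unfolding d_def l_def by (rule Min_le[OF fin]) (use that in \<open>force simp: D_def\<close>)
  have tail: "l t \<le> l r" if "r \<le> t" "t < N" for t
    using that
  proof (induction t rule: dec_induct)
    case (step t)
    then show ?case using weak[of "Suc t"] by (simp add: l_def)
  qed simp
  define es where "es = map l [0..<N]"
  have "char_poly M = (\<Prod>e\<leftarrow>es. [:- e, 1:])"
  proof -
    have "(\<Prod>i\<in>{1..N}. [:- lam i, 1:]) = (\<Prod>m\<in>{0..<N}. [:- l m, 1:])"
      unfolding l_def by (rule prod.reindex_bij_witness[of _ Suc "\<lambda>i. i - 1"]) auto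
    also have "\<dots> = (\<Prod>e\<leftarrow>es. [:- e, 1:])"
      by (simp add: es_def comp_def prod.distinct_set_conv_list[symmetric])
    finally show ?thesis using eigs by simp
  qed
  from symmetric_mat_orthogonally_diagonalizable[OF M_carrier M_sym this]
  obtain V where V: "similar_mat_wit M (mat_diag N ((!) es)) V (V\<^sup>T)" by blast
  have "mat_diag N ((!) es) = mat_diag N l"
    by (rule eq_matI) (auto simp: mat_diag_def es_def)
  note Vs = similar_mat_witD2[OF M_carrier V, unfolded this]
  interpret diagonalized_stiefel M V X N r l
  proof unfold_locales
    show "M = V * mat_diag N l * V\<^sup>T" by (rule Vs(3))
  qed (use Vs X in \<open>auto simp: stiefel_def\<close>)
  have r0: "0 < real r" using r_pos by simp
  have "(\<Sum>j<r. ip N (res j) (res j)) \<le> (\<Sum>j<r. 4 * ip N (grad j) (grad j))"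
    by (intro sum_mono res_le_grad) simp
  also have "\<dots> = (2 * frob_norm (grad_g M r X))\<^sup>2"
    by (simp add: sum_distrib_left[symmetric] power_mult_distrib frob_norm_grad_g)
  also have "\<dots> \<le> \<delta>\<^sup>2"
  proof (rule power_mono)
    show "2 * frob_norm (grad_g M r X) \<le> \<delta>"
      using small_grad unfolding D_def[symmetric] d_def[symmetric] \<delta>_def by simp
    show "0 \<le> 2 * frob_norm (grad_g M r X)"
      using frob_norm_eq[OF grad_g_carrier] by (simp add: total_nonneg)
  qed
  finally have res_small: "(\<Sum>j<r. ip N (res j) (res j)) \<le> \<delta>\<^sup>2" .
  interpret gap_frame N r l "coord X" \<delta> d
    by unfold_locales (use res_small d_pos r_pos r_lt gap tail r0 in \<open>auto simp: \<delta>_def\<close>)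
  let ?S = "{hess u | u. tangent u \<and> total u = 1}"
  have lm: "lambda_min_hess M N r X = Inf ?S"
    unfolding lambda_min_hess_def hess_values_eq ..
  from hess_dichotomy have "11/100 * d \<le> \<bar>Inf ?S\<bar>"
  proof
    assume pos: "\<forall>u. tangent u \<longrightarrow> 11/100 * d * total u \<le> hess u"
    have "?S \<noteq> {}"
      using exists_tangent_nonzero[OF r_pos r_lt] normalize_tangent by fast
    then have "11/100 * d \<le> Inf ?S"
      by (rule cInf_greatest) (use pos in force)
    then show ?thesis by simp
  next
    assume "\<exists>u. tangent u \<and> 0 < total u \<and> hess u \<le> - (11/100 * d * total u)"
    then obtain u where u: "tangent u" "0 < total u" "hess u \<le> - (11/100 * d * total u)" by blast
    obtain w where w: "tangent w" "total w = 1" "hess w = hess u / total u"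
      using normalize_tangent[OF u(1,2)] by blast
    have "bdd_below ?S"
      using hess_bounded_below unfolding bdd_below_def by fast
    then have "Inf ?S \<le> hess w" by (intro cInf_lower) (use w(1,2) in auto)
    also have "\<dots> \<le> - (11/100 * d)"
      unfolding w(3) using u(2,3) by (simp add: divide_le_eq)
    finally show ?thesis using d_pos by simp
  qed
  then show ?thesis unfolding lm d_def D_def .
qed

end
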